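(* Let $X$ be a finite group with $X=G\langle c\rangle$, where $G\le X$ is either the generalized quaternion group $Q=\langle a,b\mid a^{2n}=1,\ b^2=a^n,\ a^b=a^{-1}\rangle\cong Q_{4n}$ ($n\ge 2$) or the dihedral group $D=\langle a,b\mid a^n=b^2=1,\ a^b=a^{-1}\rangle\cong D_{2n}$ ($n\ge 2$), where $c$ has order $m\ge2$, and where $G\cap\langle c\rangle=1$. Let $M$ be the subgroup of $X$ of biggest order such that $\langle c\rangle\le M\subseteq\langle a\rangle\langle c\rangle$. Then $\langle a^2,c\rangle\le C_X(\langle c\rangle_X)$ and $|X:C_X(\langle c\rangle_X)|\le 4$. Moreover, if $\langle c\rangle_X=1$, then $M_X\cap\langle a^2\rangle\lhd M_X$. In particular, if $\langle c\rangle_X=1$ and $M=\langle a\rangle\langle c\rangle$, then $\langle a^2\rangle\lhd X$.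
   Context: For a subgroup $S\le X$, $S_X=\bigcap_{x\in X}S^x$ denotes the core of $S$ in $X$. $C_X(H)$ is the centralizer of $H$ in $X$. $x^y=y^{-1}xy$. The set product $\langle a\rangle\langle c\rangle=\{a^ic^j\}$ need not be a subgroup of $X$. All groups are finite. *)

theory Defs
  imports "HOL-Algebra.Multiplicative_Group"
begin

text \<open>
  Words in the generators of a presentation: the letter \<open>(g, True)\<close> stands for the
  generator \<open>g\<close> and \<open>(g, False)\<close> for its formal inverse. A relation is a pair of words.
\<close>

type_synonym 'g word = "('g \<times> bool) list"

text \<open>
  Equality of words in the group \<open>\<langle>g \<in> 'g | R\<rangle>\<close>: the least congruence on words that contains
  free cancellation and the relations \<open>R\<close>, that is, equality in the free group modulo
  the normal closure of the relators.
\<close>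

inductive word_eq :: "('g word \<times> 'g word) set \<Rightarrow> 'g word \<Rightarrow> 'g word \<Rightarrow> bool"
  for R :: "('g word \<times> 'g word) set" where
  refl: "word_eq R u u"
| sym: "word_eq R u v \<Longrightarrow> word_eq R v u"
| trans: "word_eq R u v \<Longrightarrow> word_eq R v w \<Longrightarrow> word_eq R u w"
| append: "word_eq R u v \<Longrightarrow> word_eq R u' v' \<Longrightarrow> word_eq R (u @ u') (v @ v')"
| cancel: "word_eq R [(g, e), (g, \<not> e)] []"
| rel: "(u, v) \<in> R \<Longrightarrow> word_eq R u v"

definition word_val :: "('x, 'r) monoid_scheme \<Rightarrow> ('g \<Rightarrow> 'x) \<Rightarrow> 'g word \<Rightarrow> 'x" where
  "word_val X f w =
     foldr (\<lambda>(g, e) y. (if e then f g else inv\<^bsub>X\<^esub> (f g)) \<otimes>\<^bsub>X\<^esub> y) w \<one>\<^bsub>X\<^esub>"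

text \<open>
  The subset \<open>G\<close> of the group \<open>X\<close> is the subgroup presented by the generators \<open>f g\<close>
  and the relations \<open>R\<close>: the homomorphism from the free group on \<open>'g\<close> to \<open>X\<close> given by \<open>f\<close>
  has image \<open>G\<close>, and its kernel is the normal closure of the relators.
\<close>

definition presented_by ::
  "('x, 'r) monoid_scheme \<Rightarrow> 'x set \<Rightarrow> ('g \<Rightarrow> 'x) \<Rightarrow> ('g word \<times> 'g word) set \<Rightarrow> bool" where
  "presented_by X G f R \<longleftrightarrow>
     range f \<subseteq> carrier X \<and> G = generate X (range f) \<and>
     (\<forall>u v. word_val X f u = word_val X f v \<longleftrightarrow> word_eq R u v)"

datatype gen = Gen_a | Gen_b

definition quaternion_rels :: "nat \<Rightarrow> (gen word \<times> gen word) set" where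
  "quaternion_rels n =
     {(replicate (2 * n) (Gen_a, True), []),
      (replicate 2 (Gen_b, True), replicate n (Gen_a, True)),
      ([(Gen_b, False), (Gen_a, True), (Gen_b, True)], [(Gen_a, False)])}"

definition dihedral_rels :: "nat \<Rightarrow> (gen word \<times> gen word) set" where
  "dihedral_rels n =
     {(replicate n (Gen_a, True), []),
      (replicate 2 (Gen_b, True), []),
      ([(Gen_b, False), (Gen_a, True), (Gen_b, True)], [(Gen_a, False)])}"

text \<open>
  \<open>quaternion_on X G a b n\<close> and \<open>dihedral_on X G a b n\<close>: with respect to the chosen
  generators \<open>a\<close> and \<open>b\<close>, the subgroup \<open>G\<close> of \<open>X\<close> is \<open>Q\<^sub>4\<^sub>n\<close> respectively \<open>D\<^sub>2\<^sub>n\<close>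
  (the subscripts are the group orders).
\<close>

definition quaternion_on ::
  "('x, 'r) monoid_scheme \<Rightarrow> 'x set \<Rightarrow> 'x \<Rightarrow> 'x \<Rightarrow> nat \<Rightarrow> bool" where
  "quaternion_on X G a b n \<longleftrightarrow>
     presented_by X G (case_gen a b) (quaternion_rels n)"

definition dihedral_on ::
  "('x, 'r) monoid_scheme \<Rightarrow> 'x set \<Rightarrow> 'x \<Rightarrow> 'x \<Rightarrow> nat \<Rightarrow> bool" where
  "dihedral_on X G a b n \<longleftrightarrow>
     presented_by X G (case_gen a b) (dihedral_rels n)"

definition centralizer :: "('x, 'r) monoid_scheme \<Rightarrow> 'x set \<Rightarrow> 'x set" where
  "centralizer X H = {x \<in> carrier X. \<forall>h\<in>H. x \<otimes>\<^bsub>X\<^esub> h = h \<otimes>\<^bsub>X\<^esub> x}"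

definition core :: "('x, 'r) monoid_scheme \<Rightarrow> 'x set \<Rightarrow> 'x set" where
  "core X S = (\<Inter>x\<in>carrier X. (\<lambda>s. inv\<^bsub>X\<^esub> x \<otimes>\<^bsub>X\<^esub> s \<otimes>\<^bsub>X\<^esub> x) ` S)"

end

theory Submission
  imports Defs "HOL-Algebra.Zassenhaus" "HOL-Computational_Algebra.Primes"
begin

text \<open>
  Write \<open>A = \<langle>a\<rangle>\<close>, \<open>C = \<langle>c\<rangle>\<close> and \<open>x\<^sup>y\<close> for conjugation. The group \<open>X\<close> acts on the cyclic normal
  subgroup \<open>C\<^sub>X\<close> through an abelian group, and \<open>a\<^sup>2\<close> is, up to inversion, the commutator of \<open>a\<close> and
  \<open>b\<close>. So \<open>a\<^sup>2\<close> and \<open>c\<close> centralise \<open>C\<^sub>X\<close>, and the four elements \<open>1, a, b, ba\<close> meet every coset of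
  the centraliser (\<open>generate_subset_centralizer\<close>, \<open>card_rcosets_centralizer\<close>).

  Now let \<open>C\<^sub>X = 1\<close>. If \<open>N\<close> is normal in \<open>X\<close> and contained in the set \<open>AC\<close>, put
  \<open>C\<^sub>1 = NG \<inter> C\<close>. Then \<open>NG = GC\<^sub>1\<close> and, because \<open>G \<inter> C = 1\<close>, the set \<open>AC\<^sub>1 = NA\<close> is a subgroup. Also no
  subgroup of \<open>C\<^sub>1\<close> except \<open>1\<close> is normal in \<open>NG\<close>, since \<open>X = GC\<close> and \<open>C\<close> is abelian. With \<open>N = M\<^sub>X\<close>, or
  with \<open>N = M\<close> when \<open>M = AC\<close>, everything follows from the case in which \<open>AC\<close> is a subgroup:

  \<^item> if \<open>AC\<close> is a subgroup normalised by \<open>b\<close>, where \<open>b\<close> inverts \<open>a\<close> and \<open>b\<^sup>2 \<in> A\<close>, and \<open>C\<close> is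
    core-free, then \<open>c\<close> normalises \<open>\<langle>a\<^sup>2\<rangle>\<close> (\<open>a_square_conj_c\<close>).

  This is an induction on the group order. As in Ito's theorem on products of abelian groups, the
  commutators \<open>[x, y]\<close> with \<open>x \<in> A\<close>, \<open>y \<in> C\<close> generate an abelian normal subgroup \<open>K\<close>. Fixed
  points of \<open>a\<close> and \<open>c\<close> in \<open>K\<close> then show that \<open>A\<close> contains a normal subgroup of the whole group,
  unless \<open>a = 1\<close> (\<open>exists_normal_subgroup_of_A\<close>). So there is a normal subgroup \<open>B \<le> A\<close> of prime order
  \<open>p\<close>. Modulo the core \<open>L\<close> of \<open>BC\<close> the induction hypothesis applies and gives
  \<open>(a\<^sup>2)\<^sup>c \<in> \<langle>a\<^sup>2\<rangle>Bc\<^sub>1\<close> with \<open>c\<^sub>1 \<in> C \<inter> L\<close>. The point is to show \<open>c\<^sub>1 = 1\<close> (\<open>no_cross_term\<close>). If not,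
  \<open>c\<^sub>1\<close> centralises \<open>B\<close> and has order \<open>p\<close>, and \<open>B\<langle>c\<^sub>1\<rangle>\<close> is a normal subgroup of order \<open>p\<^sup>2\<close>. Call
  the elements of \<open>bA\<close> reflections; all of them invert \<open>a\<close>. Writing \<open>c\<^sup>b = x f\<close> with \<open>x \<in> A\<close>, \<open>f \<in> C\<close>, the elements \<open>f\<close> and
  \<open>c\<^sup>b\<close> act alike on \<open>a\<^sup>2\<close>, so that \<open>q = f c\<^sup>-\<^sup>1\<close> multiplies \<open>a\<^sup>2\<close> by a known element:

  \<^item> For \<open>p = 2\<close> some reflection \<open>b\<close> moves \<open>c\<^sub>1\<close>, and then \<open>q\<close> multiplies \<open>a\<^sup>2\<close> by the involution of
    \<open>B\<close>. So \<open>q\<close> has even order and \<open>c\<^sub>1\<close> is a power of \<open>q\<close>. But \<open>b\<close> inverts \<open>q\<close>, hence fixes the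
    involution \<open>c\<^sub>1\<close>, a contradiction (\<open>no_cross_term_at_two\<close>).
  \<^item> For odd \<open>p\<close> every reflection inverts \<open>c\<^sub>1\<close> (\<open>inverts_at_odd_prime\<close>,
    \<open>reflection_inverts_at_odd_prime\<close>). So \<open>a = b\<^sup>-\<^sup>1 (b a)\<close> centralises \<open>c\<^sub>1\<close>, and
    \<open>\<langle>c\<^sub>1\<rangle>\<close> is normal, against core-freeness.
\<close>

section \<open>Conjugation, cyclic subgroups and commutators\<close>

definition conjugate :: "('a, 'r) monoid_scheme \<Rightarrow> 'a \<Rightarrow> 'a \<Rightarrow> 'a" (infixl "\<triangleleft>\<index>" 75)
  where "x \<triangleleft>\<^bsub>G\<^esub> y = inv\<^bsub>G\<^esub> y \<otimes>\<^bsub>G\<^esub> x \<otimes>\<^bsub>G\<^esub> y"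

context group
begin

lemma inv_cancel_left [simp]:
  "x \<in> carrier G \<Longrightarrow> y \<in> carrier G \<Longrightarrow> x \<otimes> (inv x \<otimes> y) = y"
  "x \<in> carrier G \<Longrightarrow> y \<in> carrier G \<Longrightarrow> inv x \<otimes> (x \<otimes> y) = y"
  by (simp_all flip: m_assoc)

lemmas word_simps = m_assoc inv_mult_group

lemma conjugate_closed [simp, intro]:
  "x \<in> carrier G \<Longrightarrow> y \<in> carrier G \<Longrightarrow> x \<triangleleft> y \<in> carrier G"
  by (simp add: conjugate_def)

lemma conjugate_mult:
  "x \<in> carrier G \<Longrightarrow> y \<in> carrier G \<Longrightarrow> z \<in> carrier G \<Longrightarrow> (x \<otimes> y) \<triangleleft> z = x \<triangleleft> z \<otimes> y \<triangleleft> z"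
  by (simp add: conjugate_def word_simps)

lemma conjugate_by_mult:
  "x \<in> carrier G \<Longrightarrow> y \<in> carrier G \<Longrightarrow> z \<in> carrier G \<Longrightarrow> x \<triangleleft> (y \<otimes> z) = x \<triangleleft> y \<triangleleft> z"
  by (simp add: conjugate_def word_simps)

lemma conjugate_inv:
  "x \<in> carrier G \<Longrightarrow> y \<in> carrier G \<Longrightarrow> inv x \<triangleleft> y = inv (x \<triangleleft> y)"
  by (simp add: conjugate_def word_simps)

lemma conjugate_one [simp]: "y \<in> carrier G \<Longrightarrow> \<one> \<triangleleft> y = \<one>"
  by (simp add: conjugate_def)

lemma conjugate_by_one [simp]: "x \<in> carrier G \<Longrightarrow> x \<triangleleft> \<one> = x"
  by (simp add: conjugate_def)

lemma conjugate_pow: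
  "x \<in> carrier G \<Longrightarrow> y \<in> carrier G \<Longrightarrow> (x [^] (k::nat)) \<triangleleft> y = (x \<triangleleft> y) [^] k"
  by (induction k) (simp_all add: conjugate_mult)

lemma conjugate_conjugate_inv [simp]:
  "x \<in> carrier G \<Longrightarrow> y \<in> carrier G \<Longrightarrow> x \<triangleleft> y \<triangleleft> inv y = x"
  "x \<in> carrier G \<Longrightarrow> y \<in> carrier G \<Longrightarrow> x \<triangleleft> inv y \<triangleleft> y = x"
  by (simp_all add: conjugate_def word_simps)

lemma conjugate_eq_iff [simp]:
  "x \<in> carrier G \<Longrightarrow> x' \<in> carrier G \<Longrightarrow> y \<in> carrier G \<Longrightarrow> x \<triangleleft> y = x' \<triangleleft> y \<longleftrightarrow> x = x'"
  by (metis conjugate_conjugate_inv(1))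

lemma conjugate_eq_one_iff [simp]:
  "x \<in> carrier G \<Longrightarrow> y \<in> carrier G \<Longrightarrow> x \<triangleleft> y = \<one> \<longleftrightarrow> x = \<one>"
  by (metis conjugate_eq_iff conjugate_one one_closed)

lemma conjugate_fixed_iff:
  assumes "x \<in> carrier G" "y \<in> carrier G"
  shows "x \<triangleleft> y = x \<longleftrightarrow> x \<otimes> y = y \<otimes> x"
  using assms by (metis conjugate_def inv_solve_left' m_assoc m_closed inv_closed)

lemma ord_conjugate:
  assumes "x \<in> carrier G" "y \<in> carrier G"
  shows "ord (x \<triangleleft> y) = ord x"
  using assms by (subst ord_unique) (simp_all add: pow_eq_id flip: conjugate_pow)

lemma normal_conjugate:
  "H \<lhd> G \<Longrightarrow> h \<in> H \<Longrightarrow> x \<in> carrier G \<Longrightarrow> h \<triangleleft> x \<in> H"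
  unfolding conjugate_def by (rule normal.inv_op_closed1)

lemma normalI_conjugate:
  assumes "subgroup H G" "\<And>h x. h \<in> H \<Longrightarrow> x \<in> carrier G \<Longrightarrow> h \<triangleleft> x \<in> H"
  shows "H \<lhd> G"
proof (rule normal_invI[OF assms(1)])
  fix x h assume "x \<in> carrier G" "h \<in> H"
  then show "x \<otimes> h \<otimes> inv x \<in> H" using assms(2)[of h "inv x"] by (simp add: conjugate_def)
qed

lemma mem_cyclic_self [simp]: "x \<in> generate G {x}"
  by (simp add: generate.incl)

lemma cyclic_subgroup: "x \<in> carrier G \<Longrightarrow> subgroup (generate G {x}) G"
  by (simp add: generate_is_subgroup)

lemma cyclic_incl: "subgroup H G \<Longrightarrow> x \<in> H \<Longrightarrow> generate G {x} \<subseteq> H"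
  by (rule generate_subgroup_incl) simp_all

lemma mem_cyclic_int:
  "x \<in> carrier G \<Longrightarrow> y \<in> generate G {x} \<longleftrightarrow> (\<exists>k::int. y = x [^] k)"
  by (auto simp: generate_pow)

lemma cyclic_commute:
  assumes "x \<in> carrier G" "y \<in> generate G {x}" "z \<in> generate G {x}"
  shows "y \<otimes> z = z \<otimes> y"
  using assms by (auto simp: mem_cyclic_int int_pow_mult[symmetric] add.commute)

lemma commutes_cyclic:
  assumes "x \<in> carrier G" "y \<in> carrier G" "x \<otimes> y = y \<otimes> x" "z \<in> generate G {x}"
  shows "z \<otimes> y = y \<otimes> z"
  using assms(4)
proof induction
  case (inv h)
  with assms show ?case by (metis conjugate_fixed_iff conjugate_inv inv_closed singletonD)
next
  case (eng h1 h2)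
  then have "h1 \<in> carrier G" "h2 \<in> carrier G"
    using assms generate_in_carrier[of "{x}"] by auto
  with eng assms(1,2) show ?case by (simp add: m_assoc) (simp flip: m_assoc)
qed (use assms in simp_all)

end

locale finite_group = group +
  assumes finite_carrier [simp, intro]: "finite (carrier G)"
begin

lemma mem_cyclic_nat:
  "x \<in> carrier G \<Longrightarrow> y \<in> generate G {x} \<longleftrightarrow> (\<exists>k::nat. y = x [^] k)"
  by (auto simp: generate_pow_on_finite_carrier)

text \<open>
  A finite cyclic group has a unique subgroup of each order; the divisibility of orders thus
  decides which of its elements is a power of which.
\<close>

lemma mem_cyclic_if_ord_dvd:
  assumes z: "z \<in> carrier G" and x: "x \<in> generate G {z}" and y: "y \<in> generate G {z}"
    and dvd: "ord y dvd ord x"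
  shows "y \<in> generate G {x}"
proof -
  obtain i j :: nat where ij: "x = z [^] i" "y = z [^] j"
    using x y z by (auto simp: mem_cyclic_nat)
  have pos: "ord z > 0" using z ord_ge_1[OF finite_carrier] by fastforce
  have "z [^] (j * ord x) = \<one>"
    using dvd ij z by (simp add: pow_eq_id flip: nat_pow_pow)
  then have "ord z dvd j * ord x" using z by (simp add: pow_eq_id)
  moreover have "ord z = gcd (ord z) i * ord x"
    using ij z pos by (simp add: ord_pow_gen)
  moreover have "ord x > 0"
    using ord_ge_1[OF finite_carrier, of x] ij z by fastforce
  ultimately have "gcd (ord z) i * ord x dvd j * ord x" "ord x \<noteq> 0" by (metis, simp)
  then have "gcd (ord z) i dvd j" by simp
  then obtain l where l: "j = gcd (ord z) i * l" by blast
  obtain u v where uv: "int (gcd (ord z) i) = u * int (ord z) + v * int i"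
    by (metis bezout_int gcd_int_int_eq)
  have "y = z [^] (int l * int (gcd (ord z) i))" using ij l z by (simp add: int_pow_int mult.commute flip: of_nat_mult)
  also have "\<dots> = (z [^] int (ord z)) [^] (int l * u) \<otimes> (z [^] int i) [^] (int l * v)"
    using z by (simp add: uv int_pow_pow int_pow_mult[symmetric] algebra_simps)
  also have "\<dots> = x [^] (int l * v)"
    using z ij by (simp add: int_pow_int int_pow_one)
  finally show ?thesis using ij z by (auto simp: mem_cyclic_int)
qed

lemma mem_cyclic_if_pow_prime:
  assumes z: "z \<in> carrier G" and x: "x \<in> generate G {z}" and y: "y \<in> generate G {z}"
    and p: "prime (p::nat)" and "x [^] p = \<one>" "y [^] p = \<one>" "x \<noteq> \<one>"
  shows "y \<in> generate G {x}"
proof (rule mem_cyclic_if_ord_dvd[OF z x y])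
  have "x \<in> carrier G" "y \<in> carrier G" using x y z generate_in_carrier[of "{z}"] by auto
  with assms have "ord x dvd p" "ord y dvd p" "ord x \<noteq> 1"
    using ord_eq_1[of x] by (simp_all flip: pow_eq_id)
  then show "ord y dvd ord x" using p by (metis prime_nat_iff)
qed

lemma cyclic_conjugate_closed:
  assumes "z \<in> carrier G" "x \<in> generate G {z}" "x \<triangleleft> y \<in> generate G {z}" "y \<in> carrier G"
  shows "x \<triangleleft> y \<in> generate G {x}"
proof (rule mem_cyclic_if_ord_dvd[OF assms(1-3)])
  have "x \<in> carrier G" using assms generate_in_carrier[of "{z}"] by simp
  then show "ord (x \<triangleleft> y) dvd ord x" using assms(4) by (simp add: ord_conjugate)
qed

text \<open>The automorphism group of a cyclic group is abelian.\<close>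

lemma conjugate_cyclic_commute:
  assumes "z \<in> carrier G" "x \<in> carrier G" "y \<in> carrier G"
    and "z \<triangleleft> x \<in> generate G {z}" "z \<triangleleft> y \<in> generate G {z}"
  shows "z \<triangleleft> (x \<otimes> y) = z \<triangleleft> (y \<otimes> x)"
proof -
  obtain i j :: nat where "z \<triangleleft> x = z [^] i" "z \<triangleleft> y = z [^] j"
    using assms by (auto simp: mem_cyclic_nat)
  with assms show ?thesis
    by (simp add: conjugate_by_mult conjugate_pow nat_pow_pow mult.commute)
qed

end

context group
begin

lemma generate_conjugate_closed:
  assumes S: "S \<subseteq> carrier G" and z: "z \<in> carrier G" and "\<And>s. s \<in> S \<Longrightarrow> s \<triangleleft> z \<in> S"
    and "k \<in> generate G S"
  shows "k \<triangleleft> z \<in> generate G S"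
  using assms(4)
proof induction
  case (incl h) then show ?case using assms by (simp add: generate.incl)
next
  case (inv h)
  then have "inv h \<triangleleft> z = inv (h \<triangleleft> z)" using S z by (auto simp: conjugate_inv)
  then show ?case using inv assms by (simp add: generate.inv)
next
  case (eng h1 h2)
  then have "h1 \<in> carrier G" "h2 \<in> carrier G" using generate_in_carrier[OF S] by auto
  then show ?case using eng z by (simp add: conjugate_mult generate.eng)
qed (use z in \<open>simp add: generate.one\<close>)

lemma generate_commute_right:
  assumes S: "S \<subseteq> carrier G" and x: "x \<in> carrier G" and comm: "\<And>s. s \<in> S \<Longrightarrow> s \<triangleleft> x = s"
    and k: "k \<in> generate G S"
  shows "k \<triangleleft> x = k"
  using k
proof induction
  case (inv h) then show ?case using S x comm by (auto simp: conjugate_inv)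
next
  case (eng h1 h2)
  then have "h1 \<in> carrier G" "h2 \<in> carrier G" using generate_in_carrier[OF S] by auto
  then show ?case using eng x by (simp add: conjugate_mult)
qed (use S x comm in auto)

lemma generate_commute:
  assumes S: "S \<subseteq> carrier G" and comm: "\<And>s t. s \<in> S \<Longrightarrow> t \<in> S \<Longrightarrow> s \<otimes> t = t \<otimes> s"
    and k: "k \<in> generate G S" "l \<in> generate G S"
  shows "k \<otimes> l = l \<otimes> k"
proof -
  have kl: "k \<in> carrier G" "l \<in> carrier G" using k generate_in_carrier[OF S] by auto
  have "s \<triangleleft> k = s" if "s \<in> S" for s
  proof -
    have s: "s \<in> carrier G" using that S by auto
    have "t \<triangleleft> s = t" if t: "t \<in> S" for t
    proof -
      have "t \<in> carrier G" using t S by auto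
      then show ?thesis using s t \<open>s \<in> S\<close> comm[of t s] by (simp add: conjugate_fixed_iff)
    qed
    then have "k \<triangleleft> s = k" by (rule generate_commute_right[OF S s _ k(1)])
    then show ?thesis using s kl by (simp add: conjugate_fixed_iff)
  qed
  then have "l \<triangleleft> k = l" by (rule generate_commute_right[OF S kl(1) _ k(2)])
  then show ?thesis using kl by (simp add: conjugate_fixed_iff)
qed

end

text \<open>
  Two elements with the same image under \<open>x \<mapsto> x\<^sup>-\<^sup>1 x\<^sup>z\<close> differ by a fixed point of \<open>z\<close>, and an
  injective self-map of a finite set is onto.
\<close>

lemma (in finite_group) fixed_point_free_surj:
  assumes K: "subgroup K G" and z: "z \<in> carrier G"
    and closed: "\<And>x. x \<in> K \<Longrightarrow> x \<triangleleft> z \<in> K" and free: "\<And>x. x \<in> K \<Longrightarrow> x \<triangleleft> z = x \<Longrightarrow> x = \<one>"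
    and k: "k \<in> K"
  obtains w where "w \<in> K" "w \<triangleleft> z = w \<otimes> k"
proof -
  let ?f = "\<lambda>x. inv x \<otimes> (x \<triangleleft> z)"
  have Kc [simp]: "x \<in> K \<Longrightarrow> x \<in> carrier G" for x using K by (rule subgroup.mem_carrier)
  have "inj_on ?f K"
  proof (rule inj_onI)
    fix x y assume xy: "x \<in> K" "y \<in> K" "?f x = ?f y"
    then have "y \<otimes> ?f x = y \<triangleleft> z" using z by simp
    then have "y \<otimes> inv x \<otimes> (x \<triangleleft> z) = y \<triangleleft> z" using xy z by (simp add: m_assoc)
    then have "y \<otimes> inv x = y \<triangleleft> z \<otimes> inv (x \<triangleleft> z)" using xy z by (intro inv_solve_right[THEN iffD2]) auto
    also have "\<dots> = (y \<otimes> inv x) \<triangleleft> z" using xy z by (simp add: conjugate_mult conjugate_inv)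
    finally have "(y \<otimes> inv x) \<triangleleft> z = y \<otimes> inv x" ..
    then have "y \<otimes> inv x = \<one>" using free xy K by (simp add: subgroup.m_closed subgroup.m_inv_closed)
    then show "x = y" using xy by (metis Kc inv_closed inv_equality inv_inv)
  qed
  moreover have "?f ` K \<subseteq> K" using closed K by (auto intro: subgroup.m_closed subgroup.m_inv_closed)
  moreover have "finite K" using K finite_carrier subgroup.subset finite_subset by metis
  ultimately have "?f ` K = K" by (simp add: endo_inj_surj)
  then obtain w where "w \<in> K" "k = ?f w" using k by blast
  with z show ?thesis by (intro that) auto
qed

context group
begin

lemma conjugate_by_conjugate:
  "x \<in> carrier G \<Longrightarrow> y \<in> carrier G \<Longrightarrow> z \<in> carrier G \<Longrightarrow> x \<triangleleft> (y \<triangleleft> z) = x \<triangleleft> inv z \<triangleleft> y \<triangleleft> z"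
  by (simp add: conjugate_def word_simps)

lemma conjugate_conjugate:
  "x \<in> carrier G \<Longrightarrow> y \<in> carrier G \<Longrightarrow> z \<in> carrier G \<Longrightarrow> x \<triangleleft> y \<triangleleft> z = x \<triangleleft> z \<triangleleft> (y \<triangleleft> z)"
  by (simp add: conjugate_def word_simps)

lemma conjugate_sym: "x \<in> carrier G \<Longrightarrow> y \<in> carrier G \<Longrightarrow> x \<triangleleft> y = x \<longleftrightarrow> y \<triangleleft> x = y"
  by (auto simp: conjugate_fixed_iff)

text \<open>
  The power formula in a group of nilpotency class two: every exchange of \<open>w\<close> and \<open>x\<close> costs one \<open>k\<close>.
\<close>

lemma pow_mult_central_commutator:
  fixes n :: nat
  assumes x: "x \<in> carrier G" and w: "w \<in> carrier G" and k: "k \<in> carrier G"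
    and kx: "k \<triangleleft> x = k" and kw: "k \<triangleleft> w = k" and comm: "w \<otimes> x = k \<otimes> x \<otimes> w"
  shows "(x \<otimes> w) [^] n = k [^] (\<Sum>{..<n}) \<otimes> (x [^] n \<otimes> w [^] n)"
proof -
  have kx': "k [^] (i::nat) \<otimes> x = x \<otimes> k [^] i" and kw': "k [^] (i::nat) \<otimes> w = w \<otimes> k [^] i" for i
    using kx kw k x w by (simp_all flip: conjugate_fixed_iff add: conjugate_pow)
  have kxn: "k [^] (i::nat) \<otimes> x [^] (j::nat) = x [^] j \<otimes> k [^] i" for i j
    using k x kx'[of i] by (metis conjugate_fixed_iff conjugate_pow conjugate_sym nat_pow_closed)
  have wn: "w [^] (n::nat) \<otimes> x = k [^] n \<otimes> x \<otimes> w [^] n" for n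
  proof (induction n)
    case (Suc n)
    have "w [^] Suc n \<otimes> x = w [^] n \<otimes> (k \<otimes> x \<otimes> w)" using x w by (simp add: m_assoc comm[symmetric])
    also have "w [^] n \<otimes> k = k \<otimes> w [^] n"
      using k w kw by (metis conjugate_fixed_iff conjugate_pow conjugate_sym nat_pow_closed)
    then have "w [^] n \<otimes> (k \<otimes> x \<otimes> w) = k \<otimes> (w [^] n \<otimes> x) \<otimes> w" using x w k by (simp flip: m_assoc)
    also have "\<dots> = k \<otimes> k [^] n \<otimes> x \<otimes> w [^] Suc n" using x w k by (simp add: Suc m_assoc)
    finally show ?case unfolding nat_pow_Suc2[OF k, symmetric] .
  qed (use x in simp)
  show ?thesis
  proof (induction n)
    case (Suc n)
    let ?s = "\<Sum>{..<n}"
    have "(x \<otimes> w) [^] Suc n = k [^] ?s \<otimes> (x [^] n \<otimes> (w [^] n \<otimes> x) \<otimes> w)"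
      using x w k by (simp add: Suc m_assoc)
    also have "x [^] n \<otimes> (w [^] n \<otimes> x) = k [^] n \<otimes> (x [^] Suc n \<otimes> w [^] n)"
      using x w k kxn[of n n] by (simp add: wn flip: m_assoc)
    also have "k [^] ?s \<otimes> (k [^] n \<otimes> (x [^] Suc n \<otimes> w [^] n) \<otimes> w) = k [^] (\<Sum>{..<Suc n}) \<otimes> (x [^] Suc n \<otimes> w [^] Suc n)"
      using x w k by (simp add: m_assoc lessThan_Suc flip: nat_pow_mult) (simp flip: m_assoc add: nat_pow_mult add.commute)
    finally show ?case .
  qed simp
qed

lemma pow_odd_one:
  fixes p :: nat
  assumes "x \<in> carrier G" "x [^] p = \<one>" "x \<otimes> x = \<one>" "odd p"
  shows "x = \<one>"
proof -
  have "ord x dvd p" "ord x dvd 2" using assms by (simp_all add: numeral_2_eq_2 flip: pow_eq_id)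
  then have "ord x dvd gcd p 2" by simp
  then have "ord x = 1" using assms(4) by (metis coprime_iff_gcd_eq_1 coprime_right_2_iff_odd nat_dvd_1_iff_1)
  then show ?thesis using assms ord_eq_1 by blast
qed

end

lemma odd_prime_dvd_sum_lessThan:
  fixes p t :: nat
  assumes "prime p" "odd p" "p dvd t"
  shows "p dvd \<Sum>{..<t}"
proof -
  have "2 * \<Sum>{..<t} = t * (t - 1)"
  proof (induction t)
    case (Suc t)
    then show ?case by (cases t) (simp_all add: lessThan_Suc)
  qed simp
  then have "p dvd 2 * \<Sum>{..<t}" using assms by (metis dvd_mult2)
  then show ?thesis using assms by (metis prime_dvd_mult_iff primes_dvd_imp_eq two_is_prime_nat dvd_refl)
qed

text \<open>
  Division with remainder by the least positive exponent that occurs in \<open>H\<close>.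
\<close>

lemma (in finite_group) subgroup_of_cyclic:
  assumes z: "z \<in> carrier G" and H: "subgroup H G" "H \<subseteq> generate G {z}"
  obtains k :: nat where "H = generate G {z [^] k}"
proof -
  have ord: "ord z > 0" using ord_ge_1[OF finite_carrier z] by simp
  define P where "P k \<longleftrightarrow> k > 0 \<and> z [^] k \<in> H" for k :: nat
  have "P (ord z)" unfolding P_def using ord z H by (simp add: subgroup.one_closed)
  define k where "k = (LEAST k. P k)"
  have k: "P k" unfolding k_def using \<open>P (ord z)\<close> by (rule LeastI)
  have k_le: "k \<le> i" if "P i" for i unfolding k_def using that by (rule Least_le)
  have kc: "generate G {z [^] k} \<subseteq> H" using k H(1) by (intro cyclic_incl) (simp_all add: P_def)
  have "x \<in> generate G {z [^] k}" if x: "x \<in> H" for x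
  proof -
    obtain i :: nat where i: "x = z [^] i" using x H(2) mem_cyclic_nat[OF z] by blast
    let ?w = "(z [^] k) [^] (i div k)"
    have eq: "x = ?w \<otimes> z [^] (i mod k)" using z i by (simp add: nat_pow_pow nat_pow_mult)
    have w: "?w \<in> generate G {z [^] k}" using z by (auto simp: mem_cyclic_nat)
    then have "inv ?w \<otimes> x \<in> H" using kc x by (intro subgroup.m_closed[OF H(1)] subgroup.m_inv_closed[OF H(1)]) auto
    then have "z [^] (i mod k) \<in> H" using z by (simp add: eq)
    moreover have "i mod k < k" using k by (simp add: P_def)
    ultimately have "i mod k = 0" using k_le[of "i mod k"] by (auto simp: P_def)
    then show ?thesis using w eq z by simp
  qed
  with kc have "H = generate G {z [^] k}" by blast
  then show ?thesis by (rule that)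
qed

section \<open>Quotients and cores\<close>

text \<open>
  Choosing coset representatives puts the quotient on the element type of \<open>G\<close>. An induction over
  all groups on one type can therefore pass to quotients.
\<close>

lemma normal_quotient_hom:
  fixes G :: "('a, 'r) monoid_scheme"
  assumes "N \<lhd> G"
  obtains Y :: "'a monoid" and h where "group Y" "h \<in> hom G Y" "h ` carrier G = carrier Y"
    "\<And>x. x \<in> carrier G \<Longrightarrow> h x = \<one>\<^bsub>Y\<^esub> \<longleftrightarrow> x \<in> N"
proof -
  interpret normal N G by fact
  define r where "r U = (SOME g. g \<in> U)" for U :: "'a set"
  define Y where "Y = flatten (G Mod N) r"
  have r: "r \<in> iso (G Mod N) Y" and Y: "group Y"
    unfolding r_def Y_def by (rule flatten_set_group_mod_iso flatten_set_group_mod)+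
  interpret Q: group "G Mod N" by (rule factorgroup_is_group)
  have rh: "r \<in> hom (G Mod N) Y" and rbij: "bij_betw r (carrier (G Mod N)) (carrier Y)"
    using r by (auto simp: iso_def)
  interpret r: group_hom "G Mod N" Y r using Y Q.is_group rh by (simp add: group_hom_def group_hom_axioms_def)
  let ?h = "\<lambda>x. r (N #>\<^bsub>G\<^esub> x)"
  have h: "?h \<in> hom G Y"
    using hom_mult[OF rh] hom_mult[OF r_coset_hom_Mod] hom_in_carrier[OF rh] hom_in_carrier[OF r_coset_hom_Mod]
    by (auto intro!: homI)
  have surj: "?h ` carrier G = carrier Y"
    using rbij by (auto simp: bij_betw_def FactGroup_def RCOSETS_def image_iff)
  have ker: "?h x = \<one>\<^bsub>Y\<^esub> \<longleftrightarrow> x \<in> N" if x: "x \<in> carrier G" for x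
  proof -
    have m: "N #>\<^bsub>G\<^esub> x \<in> carrier (G Mod N)" using x by (auto simp: FactGroup_def RCOSETS_def)
    have "?h x = \<one>\<^bsub>Y\<^esub> \<longleftrightarrow> r (N #>\<^bsub>G\<^esub> x) = r \<one>\<^bsub>G Mod N\<^esub>" by (simp only: r.hom_one)
    also have "\<dots> \<longleftrightarrow> N #>\<^bsub>G\<^esub> x = \<one>\<^bsub>G Mod N\<^esub>"
      using rbij m Q.one_closed by (auto simp: bij_betw_def inj_on_def)
    also have "\<dots> \<longleftrightarrow> x \<in> N"
      using x by (metis FactGroup_def coset_join1 coset_join2 monoid.simps(2) subgroup_axioms subset)
    finally show ?thesis .
  qed
  show ?thesis by (rule that[OF Y h surj ker])
qed

lemma (in group_hom) hom_conjugate: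
  "x \<in> carrier G \<Longrightarrow> y \<in> carrier G \<Longrightarrow> h (x \<triangleleft>\<^bsub>G\<^esub> y) = h x \<triangleleft>\<^bsub>H\<^esub> h y"
  by (simp add: conjugate_def)

lemma (in group_hom) hom_cyclic:
  "x \<in> carrier G \<Longrightarrow> generate H {h x} = h ` generate G {x}"
  using generate_img[of "{x}"] by simp

lemma (in group_hom) hom_set_mult:
  assumes "S \<subseteq> carrier G" "T \<subseteq> carrier G"
  shows "h ` (S <#>\<^bsub>G\<^esub> T) = h ` S <#>\<^bsub>H\<^esub> h ` T"
proof -
  have "h (x \<otimes>\<^bsub>G\<^esub> y) = h x \<otimes>\<^bsub>H\<^esub> h y" if "x \<in> S" "y \<in> T" for x y
    using that assms by (intro hom_mult) auto
  then show ?thesis by (simp add: set_mult_def image_UN)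
qed

lemma (in group) conjugate_consistent:
  "subgroup H G \<Longrightarrow> x \<in> H \<Longrightarrow> y \<in> H \<Longrightarrow> x \<triangleleft>\<^bsub>G\<lparr>carrier := H\<rparr>\<^esub> y = x \<triangleleft> y"
  by (simp add: conjugate_def)

context group
begin

lemma core_iff:
  assumes S: "subgroup S G"
  shows "x \<in> core G S \<longleftrightarrow> x \<in> carrier G \<and> (\<forall>y\<in>carrier G. x \<triangleleft> y \<in> S)"
proof -
  have Sc: "s \<in> carrier G" if "s \<in> S" for s using S that by (rule subgroup.mem_carrier)
  have "x \<in> core G S \<longleftrightarrow> (\<forall>y\<in>carrier G. \<exists>s\<in>S. x = s \<triangleleft> y)"
    by (auto simp: core_def conjugate_def)
  also have "\<dots> \<longleftrightarrow> (\<forall>y\<in>carrier G. x \<in> carrier G \<and> x \<triangleleft> inv y \<in> S)"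
    using Sc by (metis conjugate_closed conjugate_conjugate_inv(1) conjugate_conjugate_inv(2) inv_closed)
  also have "\<dots> \<longleftrightarrow> x \<in> carrier G \<and> (\<forall>y\<in>carrier G. x \<triangleleft> y \<in> S)"
    by (metis inv_closed inv_inv one_closed)
  finally show ?thesis .
qed

lemma core_normal:
  assumes S: "subgroup S G" shows "core G S \<lhd> G"
proof (rule normalI_conjugate)
  show "subgroup (core G S) G"
  proof (rule subgroupI)
    show "core G S \<noteq> {}" using S core_iff[OF S, of \<one>] by (auto simp: subgroup.one_closed)
  qed (use S in \<open>auto simp: core_iff conjugate_mult conjugate_inv subgroup.m_closed subgroup.m_inv_closed\<close>)
  fix h x assume "h \<in> core G S" "x \<in> carrier G"
  then show "h \<triangleleft> x \<in> core G S" using S by (auto simp: core_iff simp flip: conjugate_by_mult)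
qed

lemma core_subset: "subgroup S G \<Longrightarrow> core G S \<subseteq> S"
  using core_iff conjugate_by_one one_closed by (metis subsetI)

lemma core_greatest: "subgroup S G \<Longrightarrow> H \<lhd> G \<Longrightarrow> H \<subseteq> S \<Longrightarrow> H \<subseteq> core G S"
  using normal_conjugate normal_imp_subgroup subgroup.mem_carrier core_iff by (metis subset_iff)

end

section \<open>The product of two cyclic groups and an inverting element\<close>

text \<open>
  The case in which \<open>\<langle>a\<rangle>\<langle>c\<rangle>\<close> is a subgroup. The presentation of \<open>\<langle>a, b\<rangle>\<close> is replaced by the two
  consequences \<open>a\<^sup>b = a\<^sup>-\<^sup>1\<close> and \<open>b\<^sup>2 \<in> \<langle>a\<rangle>\<close>, which hold in quotients as well, where \<open>a\<close> and \<open>b\<close> may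
  satisfy further relations.
\<close>

locale inverted_product = finite_group +
  fixes a b c
  assumes a_closed [simp, intro]: "a \<in> carrier G"
    and b_closed [simp, intro]: "b \<in> carrier G"
    and c_closed [simp, intro]: "c \<in> carrier G"
    and a_conj_b: "a \<triangleleft> b = inv a"
    and b_square: "b \<otimes> b \<in> generate G {a}"
    and M_subgroup: "subgroup (generate G {a} <#> generate G {c}) G"
    and c_conj_b: "c \<triangleleft> b \<in> generate G {a} <#> generate G {c}"
    and carrier_cases:
      "x \<in> carrier G \<Longrightarrow> \<exists>y \<in> generate G {a} <#> generate G {c}. x = y \<or> x = b \<otimes> y"
    and A_Int_C: "generate G {a} \<inter> generate G {c} = {\<one>}"
begin

abbreviation "A \<equiv> generate G {a}"
abbreviation "C \<equiv> generate G {c}"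
abbreviation "M \<equiv> A <#> C"

lemma A_subgroup: "subgroup A G" and C_subgroup: "subgroup C G"
  by (simp_all add: cyclic_subgroup)

lemma A_carrier [simp]: "x \<in> A \<Longrightarrow> x \<in> carrier G"
  and C_carrier [simp]: "x \<in> C \<Longrightarrow> x \<in> carrier G"
  using A_subgroup C_subgroup by (auto dest: subgroup.mem_carrier)

lemmas A_ops [simp] = subgroup.m_closed[OF A_subgroup] subgroup.one_closed[OF A_subgroup]
  subgroup.m_inv_closed[OF A_subgroup]
lemmas C_ops [simp] = subgroup.m_closed[OF C_subgroup] subgroup.one_closed[OF C_subgroup]
  subgroup.m_inv_closed[OF C_subgroup]
lemmas M_ops [simp] = subgroup.m_closed[OF M_subgroup] subgroup.one_closed[OF M_subgroup]
  subgroup.m_inv_closed[OF M_subgroup] subgroup.mem_carrier[OF M_subgroup]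

lemma A_pow [simp]: "x \<in> A \<Longrightarrow> x [^] (k::nat) \<in> A"
  and C_pow [simp]: "y \<in> C \<Longrightarrow> y [^] (k::nat) \<in> C"
  by (induction k) auto

lemma mem_M_iff: "z \<in> M \<longleftrightarrow> (\<exists>x\<in>A. \<exists>y\<in>C. z = x \<otimes> y)"
  by (auto simp: set_mult_def)

lemma M_mult: "x \<in> A \<Longrightarrow> y \<in> C \<Longrightarrow> x \<otimes> y \<in> M"
  by (auto simp: mem_M_iff)

lemma A_subset_M [simp]: "x \<in> A \<Longrightarrow> x \<in> M"
  using M_mult[of x \<one>] by simp

lemma C_subset_M [simp]: "y \<in> C \<Longrightarrow> y \<in> M"
  using M_mult[of \<one> y] by simp

lemma M_swap:
  assumes "z \<in> M" obtains x y where "x \<in> A" "y \<in> C" "z = y \<otimes> x"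
proof -
  have "inv z \<in> M" using assms by simp
  then obtain x y where xy: "x \<in> A" "y \<in> C" "inv z = x \<otimes> y" by (auto simp: mem_M_iff)
  then have "z = inv y \<otimes> inv x" using assms by (metis A_carrier C_carrier M_ops(4) inv_inv inv_mult_group)
  with xy show ?thesis by (intro that[of "inv x" "inv y"]) auto
qed

lemma factor_unique:
  assumes "x \<in> A" "y \<in> C" "x' \<in> A" "y' \<in> C" "x \<otimes> y = x' \<otimes> y'"
  shows "x = x'" "y = y'"
proof -
  have eq: "inv x' \<otimes> x = y' \<otimes> inv y" using assms by (metis A_carrier C_carrier inv_closed inv_solve_left inv_solve_right m_assoc m_closed)
  then have "inv x' \<otimes> x \<in> A \<inter> C" using assms by (metis A_ops(1,3) C_ops(1,3) IntI)
  then have "inv x' \<otimes> x = \<one>" using A_Int_C by auto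
  with assms eq show "x = x'" "y = y'"
    by (metis A_carrier inv_closed inv_equality inv_inv, metis C_carrier inv_closed inv_equality inv_inv)
qed

lemma A_commute: "x \<in> A \<Longrightarrow> y \<in> A \<Longrightarrow> x \<otimes> y = y \<otimes> x"
  and C_commute: "x \<in> C \<Longrightarrow> y \<in> C \<Longrightarrow> x \<otimes> y = y \<otimes> x"
  by (simp_all add: cyclic_commute[of a] cyclic_commute[of c])

lemma A_conj_A [simp]: "x \<in> A \<Longrightarrow> y \<in> A \<Longrightarrow> x \<triangleleft> y = x"
  and C_conj_C [simp]: "x \<in> C \<Longrightarrow> y \<in> C \<Longrightarrow> x \<triangleleft> y = x"
  by (simp_all add: conjugate_fixed_iff A_commute C_commute)

lemma A_conj_b [simp]: "x \<in> A \<Longrightarrow> x \<triangleleft> b = inv x"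
  by (auto simp: mem_cyclic_nat conjugate_pow a_conj_b nat_pow_inv)

lemma C_conj_b: assumes "y \<in> C" shows "y \<triangleleft> b \<in> M"
proof -
  obtain k :: nat where "y = c [^] k" using assms by (auto simp: mem_cyclic_nat)
  moreover have "(c \<triangleleft> b) [^] k \<in> M" by (induction k) (use c_conj_b in auto)
  ultimately show ?thesis by (simp add: conjugate_pow)
qed

lemma M_conj_b: "z \<in> M \<Longrightarrow> z \<triangleleft> b \<in> M"
  using C_conj_b A_subset_M A_conj_b A_ops(3) M_ops(1) by (fastforce simp: mem_M_iff[of z] conjugate_mult)

lemma M_conj_M: "z \<in> M \<Longrightarrow> w \<in> M \<Longrightarrow> z \<triangleleft> w \<in> M"
  by (simp add: conjugate_def)

text \<open>
  \<open>b\<close> and \<open>b\<^sup>-\<^sup>1\<close> differ by the element \<open>b\<^sup>2\<close> of \<open>A\<close>.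
\<close>

lemma M_conj_inv_b: assumes "z \<in> M" shows "z \<triangleleft> inv b \<in> M"
proof -
  have "z \<triangleleft> inv b = z \<triangleleft> b \<triangleleft> inv (b \<otimes> b)"
    using assms by (simp add: conjugate_def word_simps)
  moreover have "inv (b \<otimes> b) \<in> M" using b_square by auto
  ultimately show ?thesis using M_conj_b M_conj_M assms by presburger
qed

lemma normalI_generators:
  assumes H: "subgroup H G"
    and gens: "\<And>h. h \<in> H \<Longrightarrow> h \<triangleleft> a \<in> H" "\<And>h. h \<in> H \<Longrightarrow> h \<triangleleft> b \<in> H" "\<And>h. h \<in> H \<Longrightarrow> h \<triangleleft> c \<in> H"
  shows "H \<lhd> G"
proof (rule normalI_conjugate[OF H])
  have Hc [simp]: "h \<in> carrier G" if "h \<in> H" for h using H that by (rule subgroup.mem_carrier)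
  have pow: "h \<triangleleft> (x [^] (k::nat)) \<in> H" if "h \<in> H" "x \<in> carrier G" "\<And>h. h \<in> H \<Longrightarrow> h \<triangleleft> x \<in> H" for h x k
    by (induction k) (use that in \<open>simp_all add: conjugate_by_mult\<close>)
  have M: "h \<triangleleft> y \<in> H" if "h \<in> H" "y \<in> M" for h y
  proof -
    obtain x w where "x \<in> A" "w \<in> C" "y = x \<otimes> w"
      using \<open>y \<in> M\<close> unfolding mem_M_iff by blast
    then obtain i j :: nat where y: "y = a [^] i \<otimes> c [^] j"
      using mem_cyclic_nat[OF a_closed, of x] mem_cyclic_nat[OF c_closed, of w] by blast
    have "h \<triangleleft> (a [^] i) \<triangleleft> (c [^] j) \<in> H" using that gens by (intro pow) auto
    then show ?thesis using that y by (simp add: conjugate_by_mult)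
  qed
  fix h x assume "h \<in> H" "x \<in> carrier G"
  with carrier_cases[of x] M gens show "h \<triangleleft> x \<in> H" by (auto simp: conjugate_by_mult)
qed

lemma cyclic_normalI:
  assumes x: "x \<in> carrier G"
    and gens: "x \<triangleleft> a \<in> generate G {x}" "x \<triangleleft> b \<in> generate G {x}" "x \<triangleleft> c \<in> generate G {x}"
  shows "generate G {x} \<lhd> G"
proof (rule normalI_generators[OF cyclic_subgroup[OF x]])
  have pow: "(x [^] (k::nat)) \<triangleleft> y \<in> generate G {x}" if y: "y \<in> carrier G" "x \<triangleleft> y \<in> generate G {x}" for y k
    using x y subgroup.m_closed[OF cyclic_subgroup[OF x]] subgroup.one_closed[OF cyclic_subgroup[OF x]]
    by (induction k) (simp_all add: conjugate_mult)
  fix h assume "h \<in> generate G {x}"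
  then obtain k :: nat where "h = x [^] k" using x by (auto simp: mem_cyclic_nat)
  with pow gens show "h \<triangleleft> a \<in> generate G {x}" "h \<triangleleft> b \<in> generate G {x}" "h \<triangleleft> c \<in> generate G {x}" by auto
qed

lemma b_square_conj_b: "(b \<otimes> b) \<triangleleft> b = b \<otimes> b"
  by (simp add: conjugate_def word_simps)

lemma b_square_square: "(b \<otimes> b) \<otimes> (b \<otimes> b) = \<one>"
proof -
  have "inv (b \<otimes> b) = b \<otimes> b" using A_conj_b[OF b_square] b_square_conj_b by (simp add: conjugate_def word_simps)
  then show ?thesis by (metis b_closed m_closed r_inv)
qed

text \<open>
  Facts proved for the reflection \<open>b\<close> thus hold for \<open>b \<otimes> a\<close> too, and the two together give
  information on \<open>a\<close>.
\<close>

lemma other_reflection: "inverted_product G a (b \<otimes> a) c"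
proof unfold_locales
  show "a \<triangleleft> (b \<otimes> a) = inv a" by (simp add: conjugate_by_mult)
  have "b \<otimes> a \<otimes> (b \<otimes> a) = b \<otimes> b \<otimes> (a \<triangleleft> b) \<otimes> a" by (simp add: conjugate_def word_simps)
  also have "\<dots> = b \<otimes> b" by (simp add: word_simps)
  finally show "b \<otimes> a \<otimes> (b \<otimes> a) \<in> A" using b_square by simp
  show "c \<triangleleft> (b \<otimes> a) \<in> M" using M_conj_M[OF c_conj_b A_subset_M, of a] by (simp add: conjugate_by_mult)
  fix x assume "x \<in> carrier G"
  from carrier_cases[OF this] obtain y where y: "y \<in> M" "x = y \<or> x = b \<otimes> y" by blast
  show "\<exists>y\<in>M. x = y \<or> x = b \<otimes> a \<otimes> y"
  proof (cases "x = y")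
    case False
    with y have "x = b \<otimes> a \<otimes> (inv a \<otimes> y)" by (simp add: word_simps)
    moreover have "inv a \<otimes> y \<in> M" using y A_subset_M[of "inv a"] by simp
    ultimately show ?thesis by blast
  qed (use y in auto)
qed (use M_subgroup A_Int_C in auto)

text \<open>
  The condition on \<open>N\<close> says that \<open>N \<inter> A C = (N \<inter> A)(N \<inter> C)\<close>; it keeps the intersection of the two
  cyclic factors trivial in the quotient.
\<close>

lemma quotient:
  fixes N
  assumes N: "N \<lhd> G" and split: "\<And>x y. x \<in> A \<Longrightarrow> y \<in> C \<Longrightarrow> x \<otimes> y \<in> N \<Longrightarrow> y \<in> N"
  obtains Y :: "'a monoid" and h where "inverted_product Y (h a) (h b) (h c)" "group_hom G Y h"
    "h ` carrier G = carrier Y" "\<And>x. x \<in> carrier G \<Longrightarrow> h x = \<one>\<^bsub>Y\<^esub> \<longleftrightarrow> x \<in> N"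
proof -
  obtain Y :: "'a monoid" and h where Y: "group Y" and h: "h \<in> hom G Y"
    and surj: "h ` carrier G = carrier Y"
    and ker: "\<And>x. x \<in> carrier G \<Longrightarrow> h x = \<one>\<^bsub>Y\<^esub> \<longleftrightarrow> x \<in> N"
    using normal_quotient_hom[OF N] by metis
  interpret Y: group Y by fact
  interpret h: group_hom G Y h using h by unfold_locales
  have A: "generate Y {h a} = h ` A" and C: "generate Y {h c} = h ` C"
    by (simp_all add: h.hom_cyclic)
  have M: "generate Y {h a} <#>\<^bsub>Y\<^esub> generate Y {h c} = h ` M"
    unfolding A C by (subst h.hom_set_mult) auto
  have "inverted_product Y (h a) (h b) (h c)"
  proof (intro inverted_product.intro finite_group.intro finite_group_axioms.intro
      inverted_product_axioms.intro Y)
    show "finite (carrier Y)" unfolding surj[symmetric] by simp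
    show "h a \<triangleleft>\<^bsub>Y\<^esub> h b = inv\<^bsub>Y\<^esub> h a" by (simp add: a_conj_b flip: h.hom_conjugate)
    show "h b \<otimes>\<^bsub>Y\<^esub> h b \<in> generate Y {h a}"
      unfolding A using b_square by (metis b_closed h.hom_mult imageI)
    show "subgroup (generate Y {h a} <#>\<^bsub>Y\<^esub> generate Y {h c}) Y"
      unfolding M by (rule h.subgroup_img_is_subgroup[OF M_subgroup])
    show "h c \<triangleleft>\<^bsub>Y\<^esub> h b \<in> generate Y {h a} <#>\<^bsub>Y\<^esub> generate Y {h c}"
      unfolding M using c_conj_b by (simp flip: h.hom_conjugate)
    show "\<exists>y\<in>generate Y {h a} <#>\<^bsub>Y\<^esub> generate Y {h c}. x = y \<or> x = h b \<otimes>\<^bsub>Y\<^esub> y"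
      if "x \<in> carrier Y" for x
    proof -
      obtain x' where x': "x' \<in> carrier G" "x = h x'" using \<open>x \<in> carrier Y\<close> surj by blast
      then obtain y where "y \<in> M" "x' = y \<or> x' = b \<otimes> y" using carrier_cases by blast
      with x' show ?thesis unfolding M by auto
    qed
    have "z = \<one>\<^bsub>Y\<^esub>" if "z \<in> h ` A" "z \<in> h ` C" for z
    proof -
      obtain x y where xy: "x \<in> A" "y \<in> C" "h x = z" "h y = z"
        using \<open>z \<in> h ` A\<close> \<open>z \<in> h ` C\<close> by (metis imageE)
      have "h (inv x \<otimes> y) = inv\<^bsub>Y\<^esub> h x \<otimes>\<^bsub>Y\<^esub> h y" using xy by simp
      also have "\<dots> = \<one>\<^bsub>Y\<^esub>" unfolding xy using xy h.hom_closed[of x] by (intro Y.l_inv) auto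
      finally have "h (inv x \<otimes> y) = \<one>\<^bsub>Y\<^esub>" .
      then have "inv x \<otimes> y \<in> N" using xy by (intro ker[THEN iffD1]) auto
      then have "y \<in> N" using split[of "inv x" y] xy by simp
      then have "h y = \<one>\<^bsub>Y\<^esub>" using xy(2) by (intro ker[THEN iffD2]) auto
      then show ?thesis using xy by simp
    qed
    then show "generate Y {h a} \<inter> generate Y {h c} = {\<one>\<^bsub>Y\<^esub>}"
      unfolding A[symmetric] C[symmetric] by (auto intro: generate.one)
  qed auto
  then show ?thesis using h.group_hom_axioms surj ker that by blast
qed

end

section \<open>A normal subgroup inside the inverted factor\<close>

locale core_free = inverted_product +
  assumes core_free: "H \<lhd> G \<Longrightarrow> H \<subseteq> generate G {c} \<Longrightarrow> H = {\<one>}"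
begin

text \<open>
  Every subgroup of \<open>C\<close> is invariant under \<open>c\<close>.
\<close>

lemma core_free_cyclic:
  assumes "y \<in> C" "y \<triangleleft> a \<in> generate G {y}" "y \<triangleleft> b \<in> generate G {y}"
  shows "y = \<one>"
proof -
  have "y \<triangleleft> c = y" using assms by simp
  then have "generate G {y} \<lhd> G" using assms by (intro cyclic_normalI) simp_all
  moreover have "generate G {y} \<subseteq> C" using assms by (intro cyclic_incl[OF C_subgroup])
  ultimately have "generate G {y} = {\<one>}" by (rule core_free)
  then show ?thesis using mem_cyclic_self[of y] by auto
qed

definition comm :: "'a \<Rightarrow> 'a \<Rightarrow> 'a" where
  "comm x y = inv x \<otimes> (x \<triangleleft> y)"

definition comms :: "'a set" where
  "comms = {comm x y | x y. x \<in> A \<and> y \<in> C}"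

lemma comm_mult_right: "x \<in> A \<Longrightarrow> z \<in> A \<Longrightarrow> y \<in> C \<Longrightarrow> comm x (z \<otimes> y) = comm x y"
  by (simp add: comm_def conjugate_by_mult)

lemma comm_mult_left: "x \<in> A \<Longrightarrow> z \<in> C \<Longrightarrow> y \<in> C \<Longrightarrow> comm (z \<otimes> x) y = comm x y"
  by (simp add: comm_def conjugate_mult word_simps)

lemma comm_conjugate:
  "x \<in> carrier G \<Longrightarrow> y \<in> carrier G \<Longrightarrow> z \<in> carrier G \<Longrightarrow> comm x y \<triangleleft> z = comm (x \<triangleleft> z) (y \<triangleleft> z)"
  by (simp add: comm_def conjugate_def word_simps)

lemma comm_closed [simp, intro]: "x \<in> carrier G \<Longrightarrow> y \<in> carrier G \<Longrightarrow> comm x y \<in> carrier G"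
  by (simp add: comm_def)

lemma comms_carrier: "comms \<subseteq> carrier G"
  by (auto simp: comms_def)

lemma comm_conj_A:
  assumes "x \<in> A" "y \<in> C" "z \<in> A" "x' \<in> A" "y' \<in> C" "y \<triangleleft> z = x' \<otimes> y'"
  shows "comm x y \<triangleleft> z = comm x y'"
  using assms by (simp add: comm_conjugate comm_mult_right)

lemma comm_conj_C:
  assumes "x \<in> A" "y \<in> C" "z \<in> C" "x' \<in> A" "y' \<in> C" "x \<triangleleft> z = y' \<otimes> x'"
  shows "comm x y \<triangleleft> z = comm x' y"
  using assms by (simp add: comm_conjugate comm_mult_left)

lemma comms_conj_a: assumes "u \<in> comms" "z \<in> A" shows "u \<triangleleft> z \<in> comms"
proof -
  obtain x y where u: "x \<in> A" "y \<in> C" "u = comm x y" using assms by (auto simp: comms_def)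
  have "y \<triangleleft> z \<in> M" using u assms by (intro M_conj_M) auto
  then obtain x' y' where "x' \<in> A" "y' \<in> C" "y \<triangleleft> z = x' \<otimes> y'" unfolding mem_M_iff by blast
  then have "u \<triangleleft> z = comm x y'" using comm_conj_A u assms by simp
  then show ?thesis using u \<open>y' \<in> C\<close> unfolding comms_def by blast
qed

lemma comms_conj_c: assumes "u \<in> comms" "z \<in> C" shows "u \<triangleleft> z \<in> comms"
proof -
  obtain x y where u: "x \<in> A" "y \<in> C" "u = comm x y" using assms by (auto simp: comms_def)
  have "x \<triangleleft> z \<in> M" using u assms by (intro M_conj_M) auto
  then obtain x' y' where "x' \<in> A" "y' \<in> C" "x \<triangleleft> z = y' \<otimes> x'" by (rule M_swap)
  then have "u \<triangleleft> z = comm x' y" using comm_conj_C u assms by simp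
  then show ?thesis using u \<open>x' \<in> A\<close> unfolding comms_def by blast
qed

lemma comms_conj_b: assumes "u \<in> comms" shows "u \<triangleleft> b \<in> comms"
proof -
  obtain x y where u: "x \<in> A" "y \<in> C" "u = comm x y" using assms by (auto simp: comms_def)
  have "y \<triangleleft> b \<in> M" using u by (intro C_conj_b)
  then obtain x' y' where "x' \<in> A" "y' \<in> C" "y \<triangleleft> b = x' \<otimes> y'" unfolding mem_M_iff by blast
  then have "u \<triangleleft> b = comm (inv x) y'" using u by (simp add: comm_conjugate comm_mult_right)
  moreover have "inv x \<in> A" using u by simp
  ultimately show ?thesis using \<open>y' \<in> C\<close> unfolding comms_def by blast
qed

text \<open>
  Ito's argument: conjugation by \<open>z \<in> A\<close> turns \<open>[x, y]\<close> into \<open>[x, y\<^sup>z]\<close>, and only the \<open>C\<close>-part of \<open>y\<^sup>z\<close>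
  matters; symmetrically for \<open>z \<in> C\<close>. So conjugations of \<open>[x, y]\<close> by \<open>A\<close> and by \<open>C\<close> act on separate
  entries and commute with each other.
\<close>

lemma comms_commute:
  assumes "u \<in> comms" "v \<in> comms" shows "u \<otimes> v = v \<otimes> u"
proof -
  obtain x y where u: "x \<in> A" "y \<in> C" "u = comm x y" using assms by (auto simp: comms_def)
  obtain x1 y1 where v: "x1 \<in> A" "y1 \<in> C" "v = comm x1 y1" using assms by (auto simp: comms_def)
  let ?x = "inv x1" and ?y = "inv y1"
  have "y \<triangleleft> ?x \<in> M" using u v by (intro M_conj_M) auto
  then obtain x2 y2 where 2: "x2 \<in> A" "y2 \<in> C" "y \<triangleleft> ?x = x2 \<otimes> y2" unfolding mem_M_iff by blast
  have "x \<triangleleft> ?y \<in> M" using u v by (intro M_conj_M) auto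
  then obtain x3 y3 where 3: "x3 \<in> A" "y3 \<in> C" "x \<triangleleft> ?y = y3 \<otimes> x3" by (rule M_swap)
  have "u \<triangleleft> ?x \<triangleleft> ?y = comm x3 y2"
    using u v 2 3 comm_conj_A[of x y ?x x2 y2] comm_conj_C[of x y2 ?y x3 y3] by simp
  also have "\<dots> = u \<triangleleft> ?y \<triangleleft> ?x"
    using u v 2 3 comm_conj_C[of x y ?y x3 y3] comm_conj_A[of x3 y ?x x2 y2] by simp
  finally have "u \<triangleleft> (?x \<otimes> ?y) = u \<triangleleft> (?y \<otimes> ?x)" using u v by (simp add: conjugate_by_mult)
  then have "u \<triangleleft> (?x \<otimes> ?y) \<triangleleft> inv (?y \<otimes> ?x) = u" using u v by simp
  moreover have "(?x \<otimes> ?y) \<otimes> inv (?y \<otimes> ?x) = v" using v by (simp add: comm_def conjugate_def word_simps)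
  ultimately have "u \<triangleleft> v = u" using u v by (simp flip: conjugate_by_mult)
  then show ?thesis using u v by (simp add: conjugate_fixed_iff)
qed

text \<open>
  Suppose not. An element of \<open>A\<close> that commutes with \<open>c\<close>, or of \<open>C\<close> that commutes with \<open>a\<close>, is central in
  \<open>M\<close>, and these elements form normal subgroups of the whole group, so they are trivial. Hence
  \<open>A\<close> and \<open>C\<close> are the centralisers of \<open>a\<close> and \<open>c\<close> in \<open>M\<close>. The abelian group \<open>K\<close> generated by
  the commutators meets \<open>A\<close> in a normal subgroup, thus trivially, and so \<open>k \<mapsto> [k, a]\<close> is bijective
  on \<open>K\<close>; this puts \<open>c\<close> into \<open>A K\<close>. Then \<open>K \<inter> C\<close> is invariant under \<open>b\<close> as well, hence trivial, and
  the same argument makes \<open>c\<close> conjugate to an element of \<open>A\<close>. In a product \<open>M = A C\<close> this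
  is possible only for \<open>c = 1\<close>, and then \<open>A\<close> itself is normal.
\<close>

lemma exists_normal_subgroup_of_A:
  assumes "a \<noteq> \<one>"
  shows "\<exists>H. H \<lhd> G \<and> H \<subseteq> A \<and> H \<noteq> {\<one>}"
proof (rule ccontr)
  assume "\<nexists>H. H \<lhd> G \<and> H \<subseteq> A \<and> H \<noteq> {\<one>}"
  then have free_A: "H \<lhd> G \<Longrightarrow> H \<subseteq> A \<Longrightarrow> H = {\<one>}" for H by blast
  have central_A: "x = \<one>" if x: "x \<in> A" "x \<triangleleft> c = x" for x
  proof -
    have "generate G {x} \<lhd> G" using x generate.inv[of x "{x}" G] by (intro cyclic_normalI) simp_all
    then have "generate G {x} = {\<one>}" using x by (intro free_A cyclic_incl[OF A_subgroup])
    then show ?thesis using mem_cyclic_self[of x] by auto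
  qed
  have ba: "b \<otimes> x = inv x \<otimes> b" if "x \<in> A" for x
  proof -
    have "b \<otimes> (inv x \<triangleleft> b) = inv x \<otimes> b" using that by (simp add: conjugate_def word_simps)
    then show ?thesis using that by simp
  qed
  have central_C: "y = \<one>" if y: "y \<in> C" "y \<triangleleft> a = y" for y
  proof -
    let ?H = "{y \<in> C. y \<triangleleft> a = y}"
    have "?H \<lhd> G"
    proof (rule normalI_generators)
      show "subgroup ?H G"
        by (rule subgroupI) (auto simp: conjugate_mult conjugate_inv intro: C_ops)
      fix y assume y: "y \<in> ?H"
      then show "y \<triangleleft> a \<in> ?H" "y \<triangleleft> c \<in> ?H" by auto
      have yA: "y \<triangleleft> x = y" if "x \<in> A" for x
      proof -
        have "y \<otimes> a = a \<otimes> y" using y by (simp flip: conjugate_fixed_iff)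
        then show ?thesis using y that commutes_cyclic[of a y x] by (simp add: conjugate_fixed_iff)
      qed
      have yM: "y \<triangleleft> z = y" if z: "z \<in> M" for z
      proof -
        obtain x w where "x \<in> A" "w \<in> C" "z = x \<otimes> w" using z unfolding mem_M_iff by blast
        then show ?thesis using y yA by (simp add: conjugate_by_mult)
      qed
      let ?w = "y \<triangleleft> b"
      have "?w \<in> M" using y by (simp add: C_conj_b)
      then obtain x' y' where w: "x' \<in> A" "y' \<in> C" "?w = x' \<otimes> y'" unfolding mem_M_iff by blast
      have "?w \<triangleleft> a = y \<triangleleft> (inv a \<otimes> b)" using y ba[of a] by (simp flip: conjugate_by_mult)
      then have wa: "?w \<triangleleft> a = ?w" using y yA[of "inv a"] by (simp add: conjugate_by_mult)
      \<comment> \<open>\<open>y\<close> is central in \<open>M\<close>, and \<open>b\<close> normalises \<open>M\<close>\<close>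
      let ?z = "c \<triangleleft> inv b"
      have "b \<otimes> c = ?z \<otimes> b" by (simp add: conjugate_def word_simps)
      then have "?w \<triangleleft> c = y \<triangleleft> (?z \<otimes> b)" using y by (simp flip: conjugate_by_mult)
      then have wc: "?w \<triangleleft> c = ?w" using y yM[of ?z] M_conj_inv_b[of c] by (simp add: conjugate_by_mult)
      have "x' \<otimes> (y' \<triangleleft> a) = x' \<otimes> y'" using wa w by (simp add: conjugate_mult)
      then have y'a: "y' \<triangleleft> a = y'" using w by simp
      have "(x' \<triangleleft> c) \<otimes> y' = x' \<otimes> y'" using wc w by (simp add: conjugate_mult)
      then have "x' = \<one>" using w central_A by simp
      with w y'a show "?w \<in> ?H" by simp
    qed
    then have "?H = {\<one>}" by (rule core_free) auto
    with y show ?thesis by auto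
  qed
  have fix_a: "z \<in> A" if z: "z \<in> M" "z \<triangleleft> a = z" for z
  proof -
    obtain x y where xy: "x \<in> A" "y \<in> C" "z = x \<otimes> y" using z unfolding mem_M_iff by blast
    then have "x \<otimes> (y \<triangleleft> a) = x \<otimes> y" using z by (simp add: conjugate_mult)
    then have "y = \<one>" using xy central_C by simp
    with xy show ?thesis by simp
  qed
  have fix_c: "z \<in> C" if z: "z \<in> M" "z \<triangleleft> c = z" for z
  proof -
    obtain x y where xy: "x \<in> A" "y \<in> C" "z = x \<otimes> y" using z unfolding mem_M_iff by blast
    then have "(x \<triangleleft> c) \<otimes> y = x \<otimes> y" using z by (simp add: conjugate_mult)
    then have "x = \<one>" using xy central_A by simp
    with xy show ?thesis by simp
  qed
  define K where "K = generate G comms"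
  have K: "subgroup K G" unfolding K_def by (rule generate_is_subgroup[OF comms_carrier])
  have Kc [simp]: "k \<in> carrier G" if "k \<in> K" for k using K that by (rule subgroup.mem_carrier)
  have comms_M: "comms \<subseteq> M"
  proof
    fix u assume "u \<in> comms"
    then obtain x y where "x \<in> A" "y \<in> C" "u = comm x y" unfolding comms_def by blast
    then show "u \<in> M" by (simp add: comm_def M_conj_M)
  qed
  have KM: "k \<in> M" if "k \<in> K" for k
    using generate_subgroup_incl[OF comms_M M_subgroup] that unfolding K_def by blast
  have K_comm: "k \<otimes> l = l \<otimes> k" if "k \<in> K" "l \<in> K" for k l
    using generate_commute[OF comms_carrier comms_commute] that unfolding K_def by blast
  have K_conj_K: "k \<triangleleft> l = k" if "k \<in> K" "l \<in> K" for k l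
    using that K_comm by (simp add: conjugate_fixed_iff)
  have K_conj: "k \<triangleleft> a \<in> K" "k \<triangleleft> b \<in> K" "k \<triangleleft> c \<in> K" if "k \<in> K" for k
    using that unfolding K_def
    by (auto intro: generate_conjugate_closed[OF comms_carrier a_closed comms_conj_a[OF _ mem_cyclic_self]]
        generate_conjugate_closed[OF comms_carrier b_closed comms_conj_b]
        generate_conjugate_closed[OF comms_carrier c_closed comms_conj_c[OF _ mem_cyclic_self]])
  define u where "u = comm a c"
  have "u \<in> comms" unfolding u_def comms_def using mem_cyclic_self by blast
  then have uK: "u \<in> K" unfolding K_def by (rule generate.incl)
  have ac: "a \<otimes> c = (c \<otimes> a) \<otimes> u" by (simp add: u_def comm_def conjugate_def word_simps)
  have K_ac: "k \<triangleleft> a \<triangleleft> c = k \<triangleleft> c \<triangleleft> a" if k: "k \<in> K" for k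
  proof -
    have "k \<triangleleft> a \<triangleleft> c = k \<triangleleft> ((c \<otimes> a) \<otimes> u)" unfolding ac[symmetric] using k by (simp add: conjugate_by_mult)
    also have "\<dots> = k \<triangleleft> c \<triangleleft> a \<triangleleft> u" using k uK by (simp add: conjugate_by_mult)
    also have "\<dots> = k \<triangleleft> c \<triangleleft> a" using k uK K_conj K_conj_K by simp
    finally show ?thesis .
  qed
  have "K \<inter> A \<lhd> G"
  proof (rule normalI_generators)
    show "subgroup (K \<inter> A) G" using K A_subgroup by (rule subgroups_Inter_pair)
    fix k assume k: "k \<in> K \<inter> A"
    then show "k \<triangleleft> a \<in> K \<inter> A" "k \<triangleleft> b \<in> K \<inter> A" using K by (auto simp: subgroup.m_inv_closed)
    have "k \<triangleleft> c \<triangleleft> a = k \<triangleleft> c" using K_ac[of k] k by simp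
    with k fix_a[OF KM[OF K_conj(3)]] K_conj(3) show "k \<triangleleft> c \<in> K \<inter> A" by blast
  qed
  then have "K \<inter> A = {\<one>}" by (rule free_A) simp
  then have free_a: "k = \<one>" if "k \<in> K" "k \<triangleleft> a = k" for k
  proof -
    have "k \<in> K \<inter> A" using that fix_a[OF KM] by blast
    with \<open>K \<inter> A = {\<one>}\<close> show ?thesis by simp
  qed
  \<comment> \<open>correct \<open>c\<close> by an element of \<open>K\<close> to one that commutes with \<open>a\<close>\<close>
  obtain w where w: "w \<in> K" "w \<triangleleft> a = w \<otimes> u"
    using fixed_point_free_surj[OF K a_closed K_conj(1) free_a uK] by blast
  define e where "e = c \<otimes> w"
  have "c \<triangleleft> a = c \<otimes> inv u" by (simp add: u_def comm_def conjugate_def word_simps)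
  then have "e \<triangleleft> a = c \<otimes> inv u \<otimes> (w \<otimes> u)" unfolding e_def using w by (simp add: conjugate_mult)
  also have "\<dots> = e" unfolding e_def using w uK K_comm[of w u] by (simp add: m_assoc)
  finally have eA: "e \<in> A" using KM[OF w(1)] unfolding e_def by (intro fix_a) simp_all
  define v where "v = inv w"
  have v: "v \<in> K" unfolding v_def using w K by (simp add: subgroup.m_inv_closed)
  have c: "c = e \<otimes> v" unfolding e_def v_def using w by (simp add: m_assoc)
  have "K \<inter> C \<lhd> G"
  proof (rule normalI_generators)
    show "subgroup (K \<inter> C) G" using K C_subgroup by (rule subgroups_Inter_pair)
    fix k assume k: "k \<in> K \<inter> C"
    then show "k \<triangleleft> c \<in> K \<inter> C" by simp
    have "k \<triangleleft> a \<triangleleft> c = k \<triangleleft> a" using K_ac[of k] k by simp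
    with k fix_c[OF KM[OF K_conj(1)]] K_conj(1) show "k \<triangleleft> a \<in> K \<inter> C" by blast
    have "k \<triangleleft> e = k \<triangleleft> c \<triangleleft> inv v" unfolding c using k eA v by (simp add: conjugate_by_mult)
    also have "\<dots> = k" using k v K_conj_K[of k "inv v"] K by (simp add: subgroup.m_inv_closed)
    finally have ke: "k \<triangleleft> inv e = k" using k eA by (metis A_carrier IntD1 Kc conjugate_conjugate_inv(1))
    have "k \<triangleleft> b \<triangleleft> c = k \<triangleleft> (b \<otimes> e) \<triangleleft> v" using k eA v by (subst c) (simp add: conjugate_by_mult)
    also have "\<dots> = k \<triangleleft> b \<triangleleft> v" using ba[OF eA] ke k eA by (simp add: conjugate_by_mult)
    also have "\<dots> = k \<triangleleft> b" using k v K_conj K_conj_K by simp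
    finally show "k \<triangleleft> b \<in> K \<inter> C" using k fix_c[OF KM[OF K_conj(2)]] K_conj(2) by blast
  qed
  then have "K \<inter> C = {\<one>}" by (rule core_free) simp
  then have free_c: "k = \<one>" if "k \<in> K" "k \<triangleleft> c = k" for k
  proof -
    have "k \<in> K \<inter> C" using that fix_c[OF KM] by blast
    with \<open>K \<inter> C = {\<one>}\<close> show ?thesis by simp
  qed
  have v': "inv v \<in> K" using v K by (simp add: subgroup.m_inv_closed)
  \<comment> \<open>likewise \<open>[w', c] = v\<^sup>-\<^sup>1\<close> makes \<open>w'\<close> conjugate \<open>e\<close> to \<open>c = e v\<close>\<close>
  obtain w' where w': "w' \<in> K" "w' \<triangleleft> c = w' \<otimes> inv v"
    using fixed_point_free_surj[OF K c_closed K_conj(3) free_c v'] by blast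
  have "w' \<triangleleft> e = w' \<triangleleft> c \<triangleleft> inv v" unfolding c using w' eA v by (simp add: conjugate_by_mult)
  also have "\<dots> = w' \<otimes> inv v" using w' v' K_conj K_conj_K by metis
  finally have "inv e \<otimes> w' \<otimes> e = w' \<otimes> inv v" by (simp add: conjugate_def)
  then have "w' \<otimes> e = e \<otimes> w' \<otimes> inv v" using w' eA v by (simp add: inv_solve_left' m_assoc)
  then have "w' \<otimes> e \<otimes> v = e \<otimes> w'" using w' eA v by (simp add: m_assoc)
  then have "e \<triangleleft> w' = c" unfolding c conjugate_def using w' eA v by (simp add: m_assoc flip: \<open>w' \<otimes> e \<otimes> v = e \<otimes> w'\<close>)
  moreover obtain x y where xy: "x \<in> A" "y \<in> C" "w' = x \<otimes> y" using KM[OF w'(1)] unfolding mem_M_iff by blast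
  ultimately have "e \<triangleleft> y = c" using eA by (simp add: conjugate_by_mult)
  then have "e \<triangleleft> y \<triangleleft> inv y = c" using xy by simp
  then have "e = c" using xy eA by simp
  then have "c = \<one>" using eA A_Int_C mem_cyclic_self[of c] by blast
  then have "a \<triangleleft> c = a" by simp
  with central_A[of a] assms show False by simp
qed

end

section \<open>Elements of prime order in the cyclic complement\<close>

context inverted_product
begin

text \<open>
  \<open>x0\<close> centralises \<open>a\<^sup>2\<close>, so \<open>f\<close> acts on it as \<open>c\<^sup>b\<close> does, that is, as \<open>c\<close> up to the inversion by \<open>b\<close>.
\<close>

lemma a_square_conj_twisted:
  assumes "x0 \<in> A" "f \<in> C" "c \<triangleleft> b = x0 \<otimes> f"
    and "a1 \<in> A" "c1 \<in> C" and gc: "(a \<otimes> a) \<triangleleft> c = a1 \<otimes> c1"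
  shows "(a \<otimes> a) \<triangleleft> f = inv (c1 \<triangleleft> b) \<otimes> a1"
proof -
  let ?g = "a \<otimes> a"
  have "?g \<triangleleft> f = ?g \<triangleleft> (c \<triangleleft> b)" using assms by (simp add: conjugate_by_mult)
  also have "\<dots> = inv ?g \<triangleleft> c \<triangleleft> b"
  proof -
    have "inv ?g \<triangleleft> b \<triangleleft> inv b = inv ?g" by (rule conjugate_conjugate_inv) auto
    then show ?thesis by (simp add: conjugate_by_conjugate)
  qed
  also have "\<dots> = inv (inv a1 \<otimes> (c1 \<triangleleft> b))" using assms by (simp add: conjugate_inv gc conjugate_mult)
  also have "\<dots> = inv (c1 \<triangleleft> b) \<otimes> a1" using assms by (simp add: inv_mult_group)
  finally show ?thesis .
qed

lemma conjugate_pow_twisted: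
  assumes "g \<in> carrier G" "q \<in> carrier G" "y \<in> carrier G" "y \<triangleleft> q = y" "g \<triangleleft> q = y \<otimes> g"
  shows "g \<triangleleft> (q [^] (k::nat)) = y [^] k \<otimes> g"
  using assms by (induction k) (simp_all add: conjugate_by_mult conjugate_mult conjugate_pow m_assoc)

text \<open>
  The powers of \<open>q\<close> multiply \<open>g\<close> by the powers of \<open>y\<close>, so \<open>p\<close> divides the order of \<open>q\<close>. Then \<open>\<langle>q\<rangle>\<close>
  contains the only subgroup of order \<open>p\<close> of \<open>C\<close>.
\<close>

lemma mem_cyclic_if_twists:
  fixes p :: nat
  assumes p: "prime p" and q: "q \<in> C" and c1: "c1 \<in> C" "c1 [^] p = \<one>"
    and g: "g \<in> carrier G" and y: "y \<in> carrier G" "y [^] p = \<one>" "y \<noteq> \<one>"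
    and twist: "y \<triangleleft> q = y" "g \<triangleleft> q = y \<otimes> g"
  shows "c1 \<in> generate G {q}"
proof -
  have "ord y dvd p" using y by (simp flip: pow_eq_id)
  then have ord_y: "ord y = p" using p y ord_eq_1[of y] prime_nat_iff by metis
  have "y [^] ord q \<otimes> g = g" using conjugate_pow_twisted[of g q y "ord q"] assms by simp
  then have "y [^] ord q = \<one>" using g y(1) by (metis l_one nat_pow_closed one_closed right_cancel)
  then have "p dvd ord q" using y by (simp add: pow_eq_id ord_y)
  moreover have "ord q > 0" using ord_ge_1[OF finite_carrier, of q] q by fastforce
  ultimately obtain n where n: "ord q = p * n" "n > 0" by (auto elim!: dvdE)
  then have "n < ord q" using prime_gt_1_nat[OF p] by simp
  then have "\<not> ord q dvd n" using n(2) by (meson dvd_imp_le not_less)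
  then have "q [^] n \<noteq> \<one>" using q by (simp add: pow_eq_id)
  moreover have "(q [^] n) [^] p = \<one>" using pow_ord_eq_1[of q] n q by (simp add: nat_pow_pow mult.commute)
  ultimately have "c1 \<in> generate G {q [^] n}"
    using q by (intro mem_cyclic_if_pow_prime[OF c_closed _ c1(1) p _ c1(2)]) simp_all
  moreover have "q [^] n \<in> generate G {q}" using q mem_cyclic_nat[of q "q [^] n"] by auto
  ultimately show ?thesis using cyclic_incl[OF cyclic_subgroup, of q "q [^] n"] q by auto
qed

text \<open>
  Let \<open>g = a\<^sup>2\<close>. If \<open>b\<close> does not invert \<open>c1\<close>, some \<open>q \<in> C\<close> multiplies \<open>g\<close> by an element \<open>y \<noteq> 1\<close> of
  \<open>\<langle>c1\<rangle>\<close>, and then \<open>c1 = q\<^sup>k\<close> with \<open>p\<close> dividing \<open>k\<close>. The square \<open>s = q\<^sup>2\<close> is conjugated by \<open>b\<close> into \<open>\<langle>g\<rangle>C\<close>,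
  say \<open>s\<^sup>b = g1 w\<close> with \<open>w \<in> C\<close>, and \<open>s\<^sup>t = c1\<close> for some \<open>t\<close> divisible by \<open>p\<close>. Let \<open>c1\<^sup>b = c1\<^sup>e\<close>. The
  commutator of \<open>g1\<close> and \<open>w\<close> lies in \<open>\<langle>c1\<rangle>\<close> and \<open>p\<close> is odd, so the \<open>t\<close>-th power of \<open>g1 w\<close> is
  \<open>g1\<^sup>t w\<^sup>t\<close>, and comparison with \<open>c1\<^sup>e\<close> gives \<open>w\<^sup>t = c1\<^sup>e\<close>. On the other hand \<open>b\<close> inverts \<open>g\<close>, so \<open>w\<close>
  acts on \<open>g\<close> like \<open>s\<^sup>-\<^sup>e\<close>. Hence \<open>v = s\<^sup>e w\<close> commutes with \<open>g\<close> although \<open>v\<^sup>t = c1\<^sup>2\<^sup>e \<noteq> 1\<close>. This is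
  impossible in the cyclic group \<open>C\<close>: since \<open>q\<close> does not commute with \<open>g\<close> and \<open>q\<^sup>p\<close> does, the \<open>p\<close>-part of \<open>v\<close> is
  a power of \<open>q\<^sup>p\<close>, whose \<open>2t\<close>-th power is \<open>c1\<^sup>p = 1\<close>.
\<close>

lemma inverts_at_odd_prime:
  fixes p :: nat
  assumes p: "prime p" "odd p"
    and c1: "c1 \<in> C" "c1 [^] p = \<one>" "c1 \<noteq> \<one>"
    and c1a: "c1 \<triangleleft> a \<in> generate G {c1}" and c1b: "c1 \<triangleleft> b \<in> generate G {c1}"
    and a1: "a1 \<in> generate G {a \<otimes> a}" and gc: "(a \<otimes> a) \<triangleleft> c = a1 \<otimes> c1"
  shows "c1 \<triangleleft> b = inv c1"
proof (rule ccontr)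
  assume neq: "c1 \<triangleleft> b \<noteq> inv c1"
  define g where "g = a \<otimes> a"
  let ?D = "generate G {c1}" and ?B = "generate G {g}"
  have gA [simp]: "g \<in> A" by (simp add: g_def)
  have D_sub: "subgroup ?D G" and B_sub: "subgroup ?B G" using c1 by (simp_all add: cyclic_subgroup)
  have DC: "?D \<subseteq> C" using c1 by (intro cyclic_incl[OF C_subgroup])
  have BA: "?B \<subseteq> A" by (intro cyclic_incl[OF A_subgroup]) simp
  have Dc [simp]: "x \<in> carrier G" if "x \<in> ?D" for x using that DC C_carrier by blast
  have a1B: "a1 \<in> ?B" using a1 by (simp add: g_def)
  then have a1A: "a1 \<in> A" using BA by blast
  have gc: "g \<triangleleft> c = a1 \<otimes> c1" using gc by (simp add: g_def)
  have D_pow: "x [^] p = \<one>" if x: "x \<in> ?D" for x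
  proof -
    obtain i :: nat where "x = c1 [^] i" using x c1 by (auto simp: mem_cyclic_nat)
    then have "x [^] p = (c1 [^] p) [^] i" using c1(1) by (simp add: nat_pow_pow mult.commute)
    then show ?thesis using c1 by simp
  qed
  have D_ord: "ord x = p" if x: "x \<in> ?D" "x \<noteq> \<one>" for x
    using D_pow[OF x(1)] x ord_eq_1[of x] p(1) by (metis Dc pow_eq_id prime_nat_iff)
  have D_pow_one: "x [^] (k::nat) = \<one> \<longleftrightarrow> p dvd k" if "x \<in> ?D" "x \<noteq> \<one>" for x k
    using that D_ord[OF that] by (simp add: pow_eq_id)
  \<comment> \<open>\<open>a\<close> and \<open>b\<close> act on \<open>\<langle>c1\<rangle>\<close> by commuting maps, and up to inversion \<open>g = a\<^sup>2\<close> is their commutator\<close>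
  have D_g: "x \<triangleleft> g = x" if x: "x \<in> ?D" for x
  proof -
    let ?k = "c1 \<triangleleft> b"
    have "a \<otimes> b = b \<otimes> (a \<triangleleft> b)" by (simp add: conjugate_def word_simps)
    then have ab: "a \<otimes> b = b \<otimes> inv a" by simp
    have "c1 \<triangleleft> (b \<otimes> a) = c1 \<triangleleft> (b \<otimes> inv a)"
      using conjugate_cyclic_commute[of c1 b a] c1 c1a c1b by (simp add: ab)
    then have "?k \<triangleleft> a = ?k \<triangleleft> inv a" using c1 by (simp add: conjugate_by_mult)
    then have "?k \<triangleleft> a \<triangleleft> a = ?k" using c1 by simp
    then have "?k \<triangleleft> g = ?k" using c1 by (simp add: conjugate_by_mult g_def)
    then have kg: "?k \<otimes> g = g \<otimes> ?k" using c1 by (simp add: conjugate_fixed_iff)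
    have "?k \<noteq> \<one>" using c1 by simp
    then have "c1 \<in> generate G {?k}"
      using c1 by (intro mem_cyclic_if_pow_prime[OF _ c1b _ p(1) D_pow[OF c1b]]) simp_all
    then have "?D \<subseteq> generate G {?k}" using c1(1) by (intro cyclic_incl[OF cyclic_subgroup]) simp_all
    then have xk: "x \<in> generate G {?k}" using x by blast
    have "x \<otimes> g = g \<otimes> x" by (rule commutes_cyclic[OF _ _ kg xk]) (simp_all add: c1)
    then show ?thesis using x by (simp add: conjugate_fixed_iff)
  qed
  have g_D: "g \<triangleleft> x = g" if "x \<in> ?D" for x using D_g[OF that] that by (simp add: conjugate_sym[of g x])
  have D_C: "x \<triangleleft> z = x" if "x \<in> ?D" "z \<in> C" for x z using that DC by auto
  obtain x0 f where f: "x0 \<in> A" "f \<in> C" "c \<triangleleft> b = x0 \<otimes> f" using c_conj_b unfolding mem_M_iff by blast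
  define y where "y = inv (c1 \<triangleleft> b) \<otimes> inv c1"
  have yD [simp]: "y \<in> ?D" unfolding y_def
    using D_sub c1b mem_cyclic_self[of c1] by (simp add: subgroup.m_closed subgroup.m_inv_closed)
  have y1: "y \<noteq> \<one>" using neq c1 unfolding y_def by (metis C_carrier b_closed conjugate_closed inv_closed inv_equality inv_inv)
  have gf: "g \<triangleleft> f = y \<otimes> (g \<triangleleft> c)"
  proof -
    have "g \<triangleleft> f = inv (c1 \<triangleleft> b) \<otimes> a1"
      unfolding g_def using f a1A c1 gc by (intro a_square_conj_twisted) (simp_all add: g_def)
    also have "\<dots> = inv (c1 \<triangleleft> b) \<otimes> (g \<triangleleft> c \<otimes> inv c1)" using a1A c1 by (simp add: gc word_simps)
    also have "g \<triangleleft> c \<otimes> inv c1 = inv c1 \<otimes> (g \<triangleleft> c)"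
    proof -
      have "inv c1 \<triangleleft> g = inv c1" using D_g D_sub mem_cyclic_self[of c1] by (simp add: subgroup.m_inv_closed)
      moreover have "inv c1 \<triangleleft> g \<triangleleft> c = inv c1 \<triangleleft> c \<triangleleft> (g \<triangleleft> c)" using c1 by (intro conjugate_conjugate) simp_all
      ultimately have "inv c1 \<triangleleft> (g \<triangleleft> c) = inv c1" using c1 by simp
      then show ?thesis using c1 by (simp add: conjugate_fixed_iff)
    qed
    finally show ?thesis using c1 by (simp add: y_def m_assoc)
  qed
  define q where "q = f \<otimes> inv c"
  have qC [simp]: "q \<in> C" using f by (simp add: q_def)
  have gq: "g \<triangleleft> q = y \<otimes> g"
    using f gf D_C[OF yD, of "inv c"] by (simp add: q_def conjugate_by_mult conjugate_mult)
  have gqk: "g \<triangleleft> (q [^] (k::nat)) = y [^] k \<otimes> g" for k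
    using D_C[OF yD qC] gq by (intro conjugate_pow_twisted) simp_all
  have cancel_g: "x = \<one>" if "x \<otimes> g = g" "x \<in> carrier G" for x
    using that by (metis A_carrier gA l_one one_closed right_cancel)
  \<comment> \<open>\<open>\<langle>c1\<rangle>\<close> is the subgroup of order \<open>p\<close> of the cyclic group \<open>\<langle>q\<rangle>\<close>\<close>
  obtain k :: nat where k: "c1 = q [^] k" "p dvd k"
  proof -
    have "c1 \<in> generate G {q}"
      using c1 y1 D_pow[OF yD] D_C[OF yD qC] gq by (intro mem_cyclic_if_twists[of p q c1 g y] p(1)) simp_all
    then obtain j :: nat where j: "c1 = q [^] j" by (auto simp: mem_cyclic_nat)
    then have "y [^] j \<otimes> g = g" using gqk[of j] g_D[of c1] by simp
    then have "y [^] j = \<one>" by (rule cancel_g) simp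
    then have "p dvd j" using D_pow_one y1 by simp
    with j show ?thesis by (rule that)
  qed
  \<comment> \<open>\<open>t\<close> inverts the squaring: \<open>s\<^sup>t = q\<^bsup>k(p + 1)\<^esup> = c1\<close>\<close>
  define s where "s = q [^] (2::nat)"
  define t where "t = k * ((p + 1) div 2)"
  have pt: "p dvd t" and t2: "2 * t = k * (p + 1)"
    using k(2) p(2) by (auto simp: t_def algebra_simps elim!: oddE)
  have sC [simp]: "s \<in> C" by (simp add: s_def)
  have q2t: "q [^] (2 * t) = c1"
  proof -
    have "q [^] (2 * t) = (q [^] k) [^] (p + 1)" by (simp only: t2 nat_pow_pow[OF C_carrier[OF qC]])
    also have "\<dots> = c1 [^] p \<otimes> c1" by (simp flip: k(1))
    also have "\<dots> = c1" using c1 by simp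
    finally show ?thesis .
  qed
  then have st: "s [^] t = c1" by (simp add: s_def nat_pow_pow)
  have gs: "g \<triangleleft> s = y [^] (2::nat) \<otimes> g" unfolding s_def by (rule gqk)
  \<comment> \<open>the subgroup \<open>\<langle>a\<^sup>2\<rangle>\<langle>c\<rangle>\<close> has index at most two in \<open>M\<close>, so it contains all squares\<close>
  define E where "E = ?B <#> ?D"
  define M1 where "M1 = ?B <#> C"
  have M1_iff: "z \<in> M1 \<longleftrightarrow> (\<exists>x\<in>?B. \<exists>y\<in>C. z = x \<otimes> y)" for z by (auto simp: M1_def set_mult_def)
  have E_iff: "z \<in> E \<longleftrightarrow> (\<exists>x\<in>?B. \<exists>y\<in>?D. z = x \<otimes> y)" for z by (auto simp: E_def set_mult_def)
  have Bc [simp]: "x \<in> carrier G" if "x \<in> ?B" for x using that BA A_carrier by blast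
  have B_D: "x \<triangleleft> d = x" if x: "x \<in> ?B" and d: "d \<in> ?D" for x d
  proof -
    have "g \<otimes> d = d \<otimes> g" using g_D[OF d] d by (simp add: conjugate_fixed_iff)
    from commutes_cyclic[OF _ _ this x] d have "x \<otimes> d = d \<otimes> x" by simp
    then show ?thesis using x d by (simp add: conjugate_fixed_iff)
  qed
  have E_mult: "z \<otimes> z' \<in> E" if z: "z \<in> E" "z' \<in> E" for z z'
  proof -
    obtain x d where xd: "x \<in> ?B" "d \<in> ?D" "z = x \<otimes> d" using z(1) unfolding E_iff by blast
    obtain x' d' where xd': "x' \<in> ?B" "d' \<in> ?D" "z' = x' \<otimes> d'" using z(2) unfolding E_iff by blast
    have "x' \<otimes> d = d \<otimes> x'" using B_D[OF xd'(1) xd(2)] xd' xd by (simp add: conjugate_fixed_iff)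
    then have "z \<otimes> z' = (x \<otimes> x') \<otimes> (d \<otimes> d')" using xd xd' by (simp add: m_assoc) (simp flip: m_assoc)
    moreover have "x \<otimes> x' \<in> ?B" "d \<otimes> d' \<in> ?D"
      using xd xd' B_sub D_sub by (simp_all add: subgroup.m_closed)
    ultimately show ?thesis unfolding E_iff by blast
  qed
  have one_E: "\<one> \<in> E" unfolding E_iff
    using subgroup.one_closed[OF B_sub] subgroup.one_closed[OF D_sub] by force
  have B_conj_c: "x \<triangleleft> c \<in> E" if x: "x \<in> ?B" for x
  proof -
    obtain i :: nat where i: "x = g [^] i" using x by (auto simp: mem_cyclic_nat)
    have "g \<triangleleft> c \<in> E" unfolding gc E_iff using a1B mem_cyclic_self[of c1] by blast
    then have "(g \<triangleleft> c) [^] i \<in> E" by (induction i) (simp_all add: E_mult one_E)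
    then show ?thesis by (simp add: i conjugate_pow)
  qed
  have E_conj_c: "z \<triangleleft> c \<in> E" if z: "z \<in> E" for z
  proof -
    obtain x d where xd: "x \<in> ?B" "d \<in> ?D" "z = x \<otimes> d" using z unfolding E_iff by blast
    have "d \<in> E" unfolding E_iff using xd(2) subgroup.one_closed[OF B_sub] by force
    then have "x \<triangleleft> c \<otimes> d \<in> E" using B_conj_c[OF xd(1)] by (intro E_mult)
    then show ?thesis using xd D_C[of d c] by (simp add: conjugate_mult)
  qed
  have E_M1: "z \<in> M1" if "z \<in> E" for z using that DC unfolding E_iff M1_iff by blast
  have E_carrier: "z \<in> carrier G" if "z \<in> E" for z using that unfolding E_iff by auto
  have B_E: "x \<in> E" if "x \<in> ?B" for x
    unfolding E_iff using that subgroup.one_closed[OF D_sub] by force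
  have B_conj_C: "x \<triangleleft> z \<in> M1" if x: "x \<in> ?B" and z: "z \<in> C" for x z
  proof -
    obtain i :: nat where i: "z = c [^] i" using z by (auto simp: mem_cyclic_nat)
    have "x \<triangleleft> (c [^] i) \<in> E"
      by (induction i) (use x in \<open>simp_all add: B_E conjugate_by_mult E_conj_c\<close>)
    then show ?thesis unfolding i by (rule E_M1)
  qed
  have M1_C: "z \<otimes> w \<in> M1" if z: "z \<in> M1" and w: "w \<in> C" for z w
  proof -
    obtain x y where "x \<in> ?B" "y \<in> C" "z = x \<otimes> y" using z unfolding M1_iff by blast
    then have "z \<otimes> w = x \<otimes> (y \<otimes> w)" "y \<otimes> w \<in> C" using w by (simp_all add: m_assoc)
    then show ?thesis using \<open>x \<in> ?B\<close> unfolding M1_iff by blast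
  qed
  have B_M1: "x \<otimes> z \<in> M1" if x: "x \<in> ?B" and z: "z \<in> M1" for x z
  proof -
    obtain x' y where "x' \<in> ?B" "y \<in> C" "z = x' \<otimes> y" using z unfolding M1_iff by blast
    then have "x \<otimes> z = (x \<otimes> x') \<otimes> y" "x \<otimes> x' \<in> ?B"
      using x B_sub by (simp_all add: m_assoc subgroup.m_closed)
    then show ?thesis using \<open>y \<in> C\<close> unfolding M1_iff by blast
  qed
  have M1_sub: "subgroup M1 G"
  proof (rule subgroupI)
    show "M1 \<subseteq> carrier G" by (auto simp: M1_iff)
    show "M1 \<noteq> {}" using E_M1[OF one_E] by blast
  next
    fix z assume "z \<in> M1"
    then obtain x y where xy: "x \<in> ?B" "y \<in> C" "z = x \<otimes> y" unfolding M1_iff by blast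
    then have "inv z = inv x \<triangleleft> y \<otimes> inv y" by (simp add: conjugate_def word_simps)
    moreover have "inv x \<in> ?B" using xy B_sub by (simp add: subgroup.m_inv_closed)
    ultimately show "inv z \<in> M1" using xy B_conj_C M1_C by simp
  next
    fix z z' assume "z \<in> M1" "z' \<in> M1"
    then obtain x y x' y' where xy: "x \<in> ?B" "y \<in> C" "z = x \<otimes> y" "x' \<in> ?B" "y' \<in> C" "z' = x' \<otimes> y'"
      unfolding M1_iff by metis
    have "z \<otimes> z' = x \<otimes> ((x' \<triangleleft> inv y) \<otimes> (y \<otimes> y'))" using xy by (simp add: conjugate_def word_simps)
    moreover have "(x' \<triangleleft> inv y) \<otimes> (y \<otimes> y') \<in> M1" using xy by (intro M1_C B_conj_C) simp_all
    ultimately show "z \<otimes> z' \<in> M1" using xy B_M1 by simp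
  qed
  note M1_ops = subgroup.m_closed[OF M1_sub] subgroup.m_inv_closed[OF M1_sub]
  have M1c: "z \<in> carrier G" if "z \<in> M1" for z using M1_sub that by (rule subgroup.mem_carrier)
  have M_cases: "z \<in> M1 \<or> (\<exists>z1\<in>M1. z = a \<otimes> z1)" if z: "z \<in> M" for z
  proof -
    obtain x y where xy: "x \<in> A" "y \<in> C" "z = x \<otimes> y" using z unfolding mem_M_iff by blast
    then obtain i :: nat where i: "x = a [^] i" by (auto simp: mem_cyclic_nat)
    have ev: "a [^] (2 * j) \<in> ?B" for j :: nat
    proof -
      have "g = a [^] (2::nat)" by (simp add: g_def numeral_2_eq_2)
      then have "a [^] (2 * j) = g [^] j" by (simp add: nat_pow_pow)
      then show ?thesis by (auto simp: mem_cyclic_nat)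
    qed
    show ?thesis
    proof (cases "even i")
      case True
      then obtain j where "i = 2 * j" by blast
      then show ?thesis using xy ev[of j] i unfolding M1_iff by blast
    next
      case False
      then obtain j where "i = Suc (2 * j)" by (auto elim: oddE)
      then have "x = a \<otimes> a [^] (2 * j)" unfolding i by (simp only: nat_pow_Suc2[OF a_closed])
      then have "z = a \<otimes> (a [^] (2 * j) \<otimes> y)" using xy by (simp add: m_assoc)
      moreover have "a [^] (2 * j) \<otimes> y \<in> M1" using xy ev[of j] unfolding M1_iff by blast
      ultimately show ?thesis by blast
    qed
  qed
  have squares: "z \<otimes> z \<in> M1" if z: "z \<in> M" for z
  proof (cases "a \<in> M1 \<or> z \<in> M1")
    case True
    then have "z \<in> M1" using M_cases[OF z] M1_ops by blast
    then show ?thesis by (simp add: M1_ops)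
  next
    case False
    then obtain z1 where z1: "z1 \<in> M1" "z = a \<otimes> z1" using M_cases[OF z] by blast
    have "z1 \<in> M" using z1(1) BA unfolding M1_iff mem_M_iff by blast
    then have "z1 \<otimes> a \<in> M" by simp
    moreover have "z1 \<otimes> a \<notin> M1"
    proof
      assume "z1 \<otimes> a \<in> M1"
      then have "inv z1 \<otimes> (z1 \<otimes> a) \<in> M1" using z1 M1_ops by blast
      then show False using False z1 M1c by simp
    qed
    ultimately obtain z2 where z2: "z2 \<in> M1" "z1 \<otimes> a = a \<otimes> z2" using M_cases by blast
    have "z \<otimes> z = a \<otimes> (z1 \<otimes> a) \<otimes> z1" using z1 M1c by (simp add: m_assoc)
    also have "\<dots> = g \<otimes> (z2 \<otimes> z1)" using z1 z2 M1c by (simp add: g_def m_assoc)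
    finally show ?thesis using z1 z2 B_M1[of g] M1_ops by simp
  qed
  have "s \<triangleleft> b = (q \<triangleleft> b) \<otimes> (q \<triangleleft> b)" by (simp add: s_def numeral_2_eq_2 conjugate_mult)
  then have "s \<triangleleft> b \<in> M1" using squares[OF C_conj_b[OF qC]] by simp
  then obtain g1 w where g1w: "g1 \<in> ?B" "w \<in> C" "s \<triangleleft> b = g1 \<otimes> w" unfolding M1_iff by blast
  define h where "h = inv (y [^] (2::nat) \<triangleleft> b)"
  obtain e :: nat where e: "c1 \<triangleleft> b = c1 [^] e" using c1 c1b by (auto simp: mem_cyclic_nat)
  have D_b: "x \<triangleleft> b = x [^] e" if x: "x \<in> ?D" for x
  proof -
    obtain i :: nat where i: "x = c1 [^] i" using x c1 by (auto simp: mem_cyclic_nat)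
    then show ?thesis using c1 by (simp add: conjugate_pow e nat_pow_pow mult.commute)
  qed
  have D_powD: "x [^] (k::nat) \<in> ?D" if "x \<in> ?D" for x k
    by (induction k) (use that D_sub in \<open>simp_all add: subgroup.one_closed subgroup.m_closed\<close>)
  have hD: "h \<in> ?D" unfolding h_def using D_b[OF D_powD[OF yD]] D_powD[OF D_powD[OF yD]] D_sub
    by (simp add: subgroup.m_inv_closed)
  have gw: "g \<triangleleft> w = h \<otimes> g"
  proof -
    have "g \<triangleleft> s \<triangleleft> b = (y [^] (2::nat) \<triangleleft> b) \<otimes> inv g" by (simp add: gs conjugate_mult)
    moreover have "g \<triangleleft> s \<triangleleft> b = inv g \<triangleleft> (g1 \<otimes> w)" by (subst conjugate_conjugate) (simp_all add: g1w)
    moreover have "g \<triangleleft> g1 = g" using g1w(1) BA by (intro A_conj_A) auto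
    ultimately have "inv (g \<triangleleft> w) = (y [^] (2::nat) \<triangleleft> b) \<otimes> inv g"
      using g1w by (simp add: conjugate_inv conjugate_by_mult)
    then have "g \<triangleleft> w = inv ((y [^] (2::nat) \<triangleleft> b) \<otimes> inv g)" using g1w by (metis C_carrier A_carrier gA conjugate_closed inv_inv)
    then have "g \<triangleleft> w = g \<otimes> h" by (simp add: h_def inv_mult_group)
    then show ?thesis using g_D[OF hD] hD by (simp add: conjugate_fixed_iff)
  qed
  obtain l :: nat where l: "g1 = g [^] l" using g1w(1) by (auto simp: mem_cyclic_nat)
  have gh: "g \<otimes> h = h \<otimes> g" using g_D[OF hD] hD by (simp add: conjugate_fixed_iff)
  have g1_w: "g1 \<triangleleft> w = h [^] l \<otimes> g1"
    unfolding l using g1w gh hD by (simp add: conjugate_pow gw pow_mult_distrib)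
  define k' where "k' = inv (h [^] l)"
  have k'D: "k' \<in> ?D" unfolding k'_def using D_powD[OF hD] D_sub by (simp add: subgroup.m_inv_closed)
  have "w \<otimes> (g1 \<triangleleft> w) = g1 \<otimes> w" using g1w by (simp add: conjugate_def m_assoc)
  then have "w \<otimes> (h [^] l) \<otimes> g1 = g1 \<otimes> w" using g1_w g1w hD by (simp add: m_assoc)
  moreover have "w \<otimes> h [^] l = h [^] l \<otimes> w" using D_powD[OF hD] DC g1w by (intro C_commute) auto
  ultimately have "h [^] l \<otimes> (w \<otimes> g1) = g1 \<otimes> w" using g1w hD by (simp add: m_assoc)
  then have "w \<otimes> g1 = k' \<otimes> (g1 \<otimes> w)" using g1w hD unfolding k'_def by (simp flip: \<open>h [^] l \<otimes> (w \<otimes> g1) = g1 \<otimes> w\<close>)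
  then have wg1: "w \<otimes> g1 = k' \<otimes> g1 \<otimes> w" using g1w k'D by (simp add: m_assoc)
  have k'g1: "k' \<triangleleft> g1 = k'" using B_D[OF g1w(1) k'D] g1w k'D conjugate_sym[of k' g1] by simp
  have "(g1 \<otimes> w) [^] t = k' [^] (\<Sum>{..<t}) \<otimes> (g1 [^] t \<otimes> w [^] t)"
    using g1w k'D k'g1 D_C[OF k'D, of w] wg1 by (intro pow_mult_central_commutator) simp_all
  also have "k' [^] (\<Sum>{..<t}) = \<one>"
    using odd_prime_dvd_sum_lessThan[OF p pt] D_pow[OF k'D] k'D by (auto simp flip: nat_pow_pow elim!: dvdE)
  finally have "c1 \<triangleleft> b = g1 [^] t \<otimes> w [^] t" using g1w by (simp add: st[symmetric] conjugate_pow)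
  then have "\<one> \<otimes> (c1 \<triangleleft> b) = g1 [^] t \<otimes> w [^] t" using c1 by (metis C_carrier b_closed conjugate_closed l_one)
  moreover have "g1 [^] t \<in> A" "c1 \<triangleleft> b \<in> C" using g1w BA c1b DC by auto
  ultimately have wt: "w [^] t = c1 [^] e"
    using factor_unique(2)[of \<one> "c1 \<triangleleft> b" "g1 [^] t" "w [^] t"] g1w e by simp
  have pe: "\<not> p dvd e"
    using D_pow_one[of c1 e] c1 e mem_cyclic_self[of c1] by (metis C_carrier b_closed conjugate_eq_one_iff)
  define v where "v = s [^] e \<otimes> w"
  have vC [simp]: "v \<in> C" using g1w by (simp add: v_def)
  have yw: "x \<triangleleft> w = x" if "x \<in> ?D" for x using D_C[OF that g1w(2)] .
  have gv: "g \<triangleleft> v = g"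
  proof -
    have "g \<triangleleft> v = g \<triangleleft> (q [^] (2 * e)) \<triangleleft> w" using g1w by (simp add: v_def s_def nat_pow_pow conjugate_by_mult)
    also have "\<dots> = y [^] (2 * e) \<otimes> (h \<otimes> g)"
      using g1w yw[OF D_powD[OF yD]] by (simp add: gqk conjugate_mult gw)
    also have "h = inv (y [^] (2 * e))" unfolding h_def using D_b[OF D_powD[OF yD]] by (simp add: nat_pow_pow)
    finally show ?thesis by simp
  qed
  have vt: "v [^] t = c1 [^] (2 * e)"
  proof -
    have "v [^] t = (s [^] t) [^] e \<otimes> w [^] t"
      unfolding v_def using g1w by (subst pow_mult_distrib) (simp_all add: C_commute nat_pow_pow mult.commute)
    then show ?thesis using c1 by (simp add: st wt nat_pow_mult mult_2)
  qed
  \<comment> \<open>dividing the exponents by their gcd gives \<open>v\<^sup>i\<^sup>' = q\<^sup>j\<^sup>'\<close> with coprime exponents: the action on \<open>g\<close>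
      forces \<open>p\<close> to divide \<open>j'\<close>, and \<open>t\<close>-th powers then force \<open>p\<close> to divide \<open>i'\<close>\<close>
  obtain i j :: nat where ij: "q = c [^] i" "v = c [^] j" using qC vC unfolding mem_cyclic_nat[OF c_closed] by metis
  have "v \<noteq> \<one>"
  proof
    assume "v = \<one>"
    then have "c1 [^] (2 * e) = \<one>" using vt by simp
    then have "p dvd 2 * e" using D_pow_one[of c1] c1 by simp
    then show False using p pe by (metis prime_dvd_mult_iff primes_dvd_imp_eq two_is_prime_nat dvd_refl)
  qed
  then have "j \<noteq> 0" using ij by (metis nat_pow_0)
  then obtain i' j' where ij': "i = gcd i j * i'" "j = gcd i j * j'" "coprime i' j'"
    by (metis gcd_coprime_exists gcd_eq_0_iff mult.commute)
  have "v [^] i' = c [^] (j * i')" using ij by (simp add: nat_pow_pow)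
  also have "j * i' = i * j'" using ij' by (metis mult.assoc mult.commute)
  also have "c [^] (i * j') = q [^] j'" using ij by (simp add: nat_pow_pow)
  finally have vq: "v [^] i' = q [^] j'" .
  have "g \<triangleleft> (v [^] i') = g" using gv by (metis A_carrier C_carrier conjugate_pow conjugate_sym gA nat_pow_closed vC)
  then have "y [^] j' \<otimes> g = g" unfolding vq gqk .
  then have "y [^] j' = \<one>" by (rule cancel_g) simp
  then have pj': "p dvd j'" using D_pow_one y1 by simp
  have "(v [^] i') [^] (2 * t) = (q [^] (2 * t)) [^] j'" unfolding vq by (simp add: nat_pow_pow mult.commute)
  also have "\<dots> = \<one>" unfolding q2t using pj' c1 D_pow_one[of c1 j'] by simp
  also have "(v [^] i') [^] (2 * t) = (v [^] t) [^] (2 * i')" by (simp add: nat_pow_pow mult.commute mult.left_commute)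
  also have "\<dots> = c1 [^] (2 * e * (2 * i'))" unfolding vt using c1 by (simp add: nat_pow_pow)
  finally have "p dvd 2 * e * (2 * i')" using D_pow_one[of c1] c1 by simp
  then have "p dvd i'" using p pe by (metis prime_dvd_mult_iff primes_dvd_imp_eq two_is_prime_nat dvd_refl)
  with pj' ij'(3) p(1) show False by (metis coprime_common_divisor_nat not_prime_1)
qed

text \<open>
  With \<open>c\<^sup>b = e f\<close> and \<open>q = f c\<^sup>-\<^sup>1\<close>, two descriptions of \<open>q\<close> clash. The square of \<open>b\<close> lies in \<open>\<langle>\<beta>\<rangle>\<close>, so
  it commutes with \<open>c\<close>, and conjugating \<open>c\<^sup>b = e f\<close> by \<open>b\<close> once more shows that \<open>b\<close> inverts \<open>q\<close>. On the
  other hand \<open>q\<close> multiplies \<open>a\<^sup>2\<close> by \<open>\<beta>\<close>, so the involution \<open>c1\<close> is a power of \<open>q\<close> and \<open>b\<close> fixes it.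
\<close>

lemma no_cross_term_at_two:
  assumes \<beta>: "\<beta> \<in> A" "\<beta> \<otimes> \<beta> = \<one>" "\<beta> \<noteq> \<one>" "\<beta> \<triangleleft> c = \<beta>"
    and c1: "c1 \<in> C" "c1 \<otimes> c1 = \<one>" "c1 \<triangleleft> b = \<beta> \<otimes> c1" "c1 \<triangleleft> (a \<otimes> a) = c1"
    and a1: "a1 \<in> A" and gc: "(a \<otimes> a) \<triangleleft> c = a1 \<otimes> c1"
  shows False
proof -
  let ?g = "a \<otimes> a"
  have pow2: "x [^] (2::nat) = x \<otimes> x" if "x \<in> carrier G" for x using that by (simp add: numeral_2_eq_2)
  have \<beta>c: "c \<triangleleft> \<beta> = c" using \<beta> by (simp add: conjugate_sym[of c \<beta>])
  have bb: "b \<otimes> b \<in> generate G {\<beta>}"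
    using b_square_square \<beta>
    by (intro mem_cyclic_if_pow_prime[OF a_closed \<beta>(1) b_square two_is_prime_nat]) (simp_all add: pow2)
  have "\<beta> \<otimes> c = c \<otimes> \<beta>" using \<beta> by (simp flip: conjugate_fixed_iff)
  from commutes_cyclic[OF _ _ this bb] have "(b \<otimes> b) \<otimes> c = c \<otimes> (b \<otimes> b)" using \<beta> by simp
  then have cbb: "c \<triangleleft> (b \<otimes> b) = c" by (simp add: conjugate_fixed_iff)
  obtain e f where f: "e \<in> A" "f \<in> C" "c \<triangleleft> b = e \<otimes> f" using c_conj_b unfolding mem_M_iff by blast
  have "inv e \<otimes> (f \<triangleleft> b) = c" using cbb f by (simp add: conjugate_by_mult conjugate_mult)
  then have fb: "f \<triangleleft> b = e \<otimes> c" using f by (metis A_carrier C_carrier b_closed conjugate_closed inv_cancel_left(1))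
  define q where "q = inv c \<otimes> f"
  have qC [simp]: "q \<in> C" using f by (simp add: q_def)
  have q_swap: "q = f \<otimes> inv c" using f by (simp add: q_def C_commute)
  have "q \<triangleleft> b = inv (e \<otimes> f) \<otimes> (e \<otimes> c)" using f by (simp add: q_def conjugate_mult conjugate_inv fb)
  also have "\<dots> = inv q" using f by (simp add: q_def word_simps)
  finally have qb: "q \<triangleleft> b = inv q" .
  have \<beta>C: "\<beta> \<triangleleft> y = \<beta>" if y: "y \<in> C" for y
  proof -
    have "c \<otimes> \<beta> = \<beta> \<otimes> c" using \<open>\<beta> \<otimes> c = c \<otimes> \<beta>\<close> ..
    from commutes_cyclic[OF _ _ this y] show ?thesis using \<beta> y by (simp add: conjugate_fixed_iff)
  qed
  have c1_inv: "inv c1 = c1" using c1 by (metis C_carrier inv_equality)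
  have \<beta>_inv: "inv \<beta> = \<beta>" using \<beta> by (metis A_carrier inv_equality)
  have "c1 \<triangleleft> (?g \<triangleleft> c) = c1"
  proof -
    have "c1 \<triangleleft> ?g \<triangleleft> c = c1 \<triangleleft> c \<triangleleft> (?g \<triangleleft> c)" using c1 by (intro conjugate_conjugate) simp_all
    then show ?thesis using c1 by simp
  qed
  then have "c1 \<otimes> (a1 \<otimes> c1) = a1 \<otimes> c1 \<otimes> c1" using c1 a1 by (simp add: gc conjugate_fixed_iff)
  then have c1a1: "c1 \<otimes> a1 = a1 \<otimes> c1" using c1 a1 by (metis A_carrier C_carrier m_assoc m_closed right_cancel)
  have "?g \<triangleleft> f = inv (\<beta> \<otimes> c1) \<otimes> a1" using a_square_conj_twisted[OF f a1 c1(1) gc] by (simp add: c1)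
  also have "\<dots> = c1 \<otimes> a1 \<otimes> \<beta>" using c1 \<beta> a1 by (simp add: inv_mult_group c1_inv \<beta>_inv m_assoc A_commute)
  also have "\<dots> = a1 \<otimes> (c1 \<otimes> \<beta>)" using c1 \<beta> a1 by (simp add: c1a1 m_assoc)
  also have "c1 \<otimes> \<beta> = \<beta> \<otimes> c1" using \<beta>C[OF c1(1)] c1 \<beta> by (simp add: conjugate_fixed_iff)
  also have "a1 \<otimes> (\<beta> \<otimes> c1) = \<beta> \<otimes> (?g \<triangleleft> c)" using c1 \<beta> a1 A_commute[of a1 \<beta>] by (simp add: gc flip: m_assoc)
  finally have gf: "?g \<triangleleft> f = \<beta> \<otimes> (?g \<triangleleft> c)" .
  have "?g \<triangleleft> q = ?g \<triangleleft> f \<triangleleft> inv c" unfolding q_swap using f by (simp add: conjugate_by_mult)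
  also have "\<dots> = \<beta> \<otimes> ?g" unfolding gf using \<beta> \<beta>C[of "inv c"] by (simp add: conjugate_mult[of \<beta> "?g \<triangleleft> c" "inv c"] del: conjugate_mult)
  finally have gq: "?g \<triangleleft> q = \<beta> \<otimes> ?g" .
  have "c1 \<in> generate G {q}"
    using c1 \<beta> \<beta>C[OF qC] gq by (intro mem_cyclic_if_twists[of 2 q c1 ?g \<beta>]) (simp_all add: pow2)
  then obtain j :: nat where "c1 = q [^] j" by (auto simp: mem_cyclic_nat)
  then have "c1 \<triangleleft> b = inv c1" by (simp add: conjugate_pow qb nat_pow_inv)
  then have "\<beta> \<otimes> c1 = c1" by (simp add: c1 c1_inv)
  then show False using \<beta> c1 by (metis A_carrier C_carrier l_one one_closed right_cancel)
qed

text \<open>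
  In the quotient by \<open>\<langle>\<beta>\<rangle>\<close> the reflection \<open>b\<close> inverts \<open>c1\<close>, so \<open>c1\<^sup>b = x c1\<^sup>-\<^sup>1\<close> with \<open>x \<in> \<langle>\<beta>\<rangle>\<close>. Then \<open>b\<^sup>4 = 1\<close>
  multiplies \<open>c1\<close> by \<open>x\<^sup>-\<^sup>4\<close>, and \<open>x = 1\<close> because \<open>p\<close> is odd.
\<close>

lemma reflection_inverts_at_odd_prime:
  fixes p :: nat
  assumes p: "prime p" "odd p"
    and \<beta>: "\<beta> \<in> A" "\<beta> [^] p = \<one>" and B: "generate G {\<beta>} \<lhd> G"
    and c1: "c1 \<in> C" "c1 [^] p = \<one>" "c1 \<noteq> \<one>" "c1 \<triangleleft> \<beta> = c1"
    and conj: "\<And>y. y \<in> carrier G \<Longrightarrow> \<exists>x\<in>generate G {\<beta>}. \<exists>d\<in>generate G {c1}. c1 \<triangleleft> y = x \<otimes> d"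
    and a1: "a1 \<in> generate G {a \<otimes> a}" and gc: "(a \<otimes> a) \<triangleleft> c = a1 \<otimes> c1"
  shows "c1 \<triangleleft> b = inv c1"
proof -
  let ?B = "generate G {\<beta>}" and ?D = "generate G {c1}"
  have BA: "?B \<subseteq> A" using \<beta> by (intro cyclic_incl[OF A_subgroup])
  have DC: "?D \<subseteq> C" using c1 by (intro cyclic_incl[OF C_subgroup])
  have B_sub: "subgroup ?B G" using B by (rule normal_imp_subgroup)
  have Bc [simp]: "x \<in> carrier G" if "x \<in> ?B" for x using that BA A_carrier by blast
  have split: "y \<in> ?B" if "x \<in> A" "y \<in> C" "x \<otimes> y \<in> ?B" for x y
  proof -
    have "x \<otimes> y \<in> A" using that BA by blast
    then have "y = \<one>" using factor_unique(2)[of x y "x \<otimes> y" \<one>] that by simp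
    then show ?thesis using subgroup.one_closed[OF B_sub] by simp
  qed
  obtain Y :: "'a monoid" and h where Y: "inverted_product Y (h a) (h b) (h c)" and h: "group_hom G Y h"
    and surj: "h ` carrier G = carrier Y" and ker: "\<And>x. x \<in> carrier G \<Longrightarrow> h x = \<one>\<^bsub>Y\<^esub> \<longleftrightarrow> x \<in> ?B"
    by (rule quotient[OF B]) (use split in blast, use that in blast)
  interpret Y: inverted_product Y "h a" "h b" "h c" by (rule Y)
  interpret h: group_hom G Y h by (rule h)
  have hD: "h x \<in> generate Y {h c1}" if "x \<in> ?D" for x
    using that c1 by (simp add: h.hom_cyclic)
  have h_conj: "h c1 \<triangleleft>\<^bsub>Y\<^esub> h y \<in> generate Y {h c1}" if y: "y \<in> carrier G" for y
  proof -
    obtain x d where xd: "x \<in> ?B" "d \<in> ?D" "c1 \<triangleleft> y = x \<otimes> d" using conj[OF y] by blast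
    have d: "d \<in> carrier G" using xd DC C_carrier by blast
    have "h c1 \<triangleleft>\<^bsub>Y\<^esub> h y = h x \<otimes>\<^bsub>Y\<^esub> h d" using c1 y xd d by (simp flip: h.hom_conjugate)
    moreover have "h x = \<one>\<^bsub>Y\<^esub>" using ker xd by simp
    ultimately show ?thesis using hD xd d by simp
  qed
  have "c1 \<notin> ?B" using c1 BA A_Int_C by blast
  then have c1_ne: "h c1 \<noteq> \<one>\<^bsub>Y\<^esub>" using ker c1 by simp
  have aa: "h a \<otimes>\<^bsub>Y\<^esub> h a = h (a \<otimes> a)" by simp
  have a1c: "a1 \<in> carrier G" using a1 generate_in_carrier[of "{a \<otimes> a}"] by simp
  have "h c1 \<triangleleft>\<^bsub>Y\<^esub> h b = inv\<^bsub>Y\<^esub> h c1"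
  proof (rule Y.inverts_at_odd_prime[OF p _ _ c1_ne h_conj h_conj, of "h a1"])
    show "h c1 \<in> generate Y {h c}" using c1 by (simp add: h.hom_cyclic)
    show "h c1 [^]\<^bsub>Y\<^esub> p = \<one>\<^bsub>Y\<^esub>" using c1 by (simp flip: h.hom_nat_pow)
    show "h a1 \<in> generate Y {h a \<otimes>\<^bsub>Y\<^esub> h a}" unfolding aa using a1 by (subst h.hom_cyclic) auto
    show "(h a \<otimes>\<^bsub>Y\<^esub> h a) \<triangleleft>\<^bsub>Y\<^esub> h c = h a1 \<otimes>\<^bsub>Y\<^esub> h c1"
      unfolding aa using c1 a1c by (simp add: gc flip: h.hom_conjugate h.hom_mult)
  qed simp_all
  then have "h ((c1 \<triangleleft> b) \<otimes> c1) = \<one>\<^bsub>Y\<^esub>" using c1 by (simp add: h.hom_conjugate)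
  then have "(c1 \<triangleleft> b) \<otimes> c1 \<in> ?B" using c1 by (intro ker[THEN iffD1]) simp_all
  then obtain x where x: "x \<in> ?B" "(c1 \<triangleleft> b) \<otimes> c1 = x" by blast
  then have c1b: "c1 \<triangleleft> b = x \<otimes> inv c1" using c1 by (metis Bc C_carrier b_closed conjugate_closed inv_solve_right)
  have xA: "x \<in> A" using x BA by blast
  have B_c1: "c1 \<triangleleft> z = c1" if z: "z \<in> ?B" for z
  proof -
    have "\<beta> \<otimes> c1 = c1 \<otimes> \<beta>" using c1 \<beta> by (simp flip: conjugate_sym[of c1 \<beta>] add: conjugate_fixed_iff)
    from commutes_cyclic[OF _ _ this z] show ?thesis using c1 \<beta> z by (simp add: conjugate_fixed_iff)
  qed
  have c1x: "c1 \<otimes> inv x = inv x \<otimes> c1"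
    using B_c1[of "inv x"] x c1 B_sub by (simp add: conjugate_fixed_iff subgroup.m_inv_closed)
  define z where "z = inv x \<otimes> inv x"
  have zB: "z \<in> ?B" unfolding z_def using x B_sub by (simp add: subgroup.m_inv_closed subgroup.m_closed)
  have zA: "z \<in> A" using zB BA by blast
  have "c1 \<triangleleft> (b \<otimes> b) = inv x \<otimes> inv (x \<otimes> inv c1)"
    using c1 xA by (simp add: conjugate_by_mult c1b conjugate_mult conjugate_inv)
  also have "\<dots> = z \<otimes> c1" using c1 xA by (simp add: inv_mult_group c1x z_def m_assoc)
  finally have bb: "c1 \<triangleleft> (b \<otimes> b) = z \<otimes> c1" .
  have "c1 = c1 \<triangleleft> ((b \<otimes> b) \<otimes> (b \<otimes> b))" unfolding b_square_square using c1 by simp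
  also have "\<dots> = z \<otimes> (z \<otimes> c1)"
    using c1 zA b_square by (simp add: conjugate_by_mult[of c1 "b \<otimes> b" "b \<otimes> b"] bb conjugate_mult del: conjugate_by_mult)
  finally have "z \<otimes> z = \<one>" using c1 zA by (metis A_carrier C_carrier l_one m_assoc m_closed one_closed right_cancel)
  moreover have B_pow: "w [^] p = \<one>" if w: "w \<in> ?B" for w
  proof -
    obtain i :: nat where "w = \<beta> [^] i" using w \<beta> by (auto simp: mem_cyclic_nat)
    then have "w [^] p = (\<beta> [^] p) [^] i" using \<beta>(1) by (simp add: nat_pow_pow mult.commute)
    then show ?thesis using \<beta> by simp
  qed
  ultimately have "z = \<one>" using zB p by (intro pow_odd_one[of z p]) simp_all
  then have "inv x = \<one>" using x B_sub B_pow p unfolding z_def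
    by (intro pow_odd_one[of "inv x" p]) (simp_all add: subgroup.m_inv_closed)
  then have "x = \<one>" using x by simp
  then show ?thesis using c1b c1 by simp
qed

end

section \<open>The square of the inverted generator spans a normal subgroup\<close>

context core_free
begin

text \<open>
  Here \<open>c1\<close> is the obstruction that is left after the induction hypothesis has been used modulo \<open>L\<close>.
  The centraliser of \<open>\<beta>\<close> in \<open>L\<close> is \<open>N = \<langle>\<beta>\<rangle> \<times> (N \<inter> C)\<close>. Its \<open>p\<close>-th powers lie in \<open>C\<close> and form a normal
  subgroup, so they are trivial, and \<open>N\<close> has order \<open>p\<^sup>2\<close> as soon as \<open>c1 \<noteq> 1\<close>.
\<close>

lemma no_cross_term:
  fixes p :: nat
  assumes p: "prime p"
    and \<beta>: "\<beta> \<in> A" "\<beta> [^] p = \<one>" "\<beta> \<noteq> \<one>" and B: "generate G {\<beta>} \<lhd> G"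
    and L: "L \<lhd> G" "generate G {\<beta>} \<subseteq> L" "L \<subseteq> generate G {\<beta>} <#> C"
    and x: "x \<in> generate G {a \<otimes> a}" and x1: "x1 \<in> generate G {\<beta>}" and c1: "c1 \<in> C" "c1 \<in> L"
    and gc: "(a \<otimes> a) \<triangleleft> c = x \<otimes> x1 \<otimes> c1"
  shows "c1 = \<one>"
proof (rule ccontr)
  assume ne: "c1 \<noteq> \<one>"
  let ?g = "a \<otimes> a" and ?B = "generate G {\<beta>}" and ?D = "generate G {c1}"
  define a1 where "a1 = x \<otimes> x1"
  have BA: "?B \<subseteq> A" using \<beta> by (intro cyclic_incl[OF A_subgroup])
  have gA: "generate G {?g} \<subseteq> A" by (intro cyclic_incl[OF A_subgroup]) simp
  have a1: "a1 \<in> A" unfolding a1_def using x x1 BA gA by (intro A_ops) auto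
  have gc: "?g \<triangleleft> c = a1 \<otimes> c1" using gc by (simp add: a1_def)
  have B_sub: "subgroup ?B G" and L_sub: "subgroup L G" using B L by (simp_all add: normal_imp_subgroup)
  have Bc [simp]: "z \<in> carrier G" if "z \<in> ?B" for z using that BA A_carrier by blast
  have Lc [simp]: "z \<in> carrier G" if "z \<in> L" for z using L_sub that by (rule subgroup.mem_carrier)
  have B_pow: "w [^] p = \<one>" if w: "w \<in> ?B" for w
  proof -
    obtain i :: nat where "w = \<beta> [^] i" using w \<beta> by (auto simp: mem_cyclic_nat)
    then have "w [^] p = (\<beta> [^] p) [^] i" using \<beta>(1) by (simp add: nat_pow_pow mult.commute)
    then show ?thesis using \<beta> by simp
  qed
  have c1_notin: "c1 \<notin> ?B" using c1 BA A_Int_C ne by blast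
  \<comment> \<open>\<open>a\<^sup>2\<close> centralises the normal subgroup \<open>\<langle>\<beta>\<rangle>\<close>, hence so does its conjugate\<close>
  have \<beta>_c1: "c1 \<triangleleft> \<beta> = c1"
  proof -
    let ?\<beta>' = "\<beta> \<triangleleft> c"
    have \<beta>': "?\<beta>' \<in> ?B" by (rule normal_conjugate[OF B]) simp_all
    have "\<beta> \<in> generate G {?\<beta>'}"
      using \<beta> \<beta>' B_pow[OF \<beta>'] by (intro mem_cyclic_if_pow_prime[OF _ \<beta>' _ p]) simp_all
    moreover have "?\<beta>' \<triangleleft> (?g \<triangleleft> c) = ?\<beta>'"
    proof -
      have "\<beta> \<triangleleft> ?g \<triangleleft> c = ?\<beta>' \<triangleleft> (?g \<triangleleft> c)" using \<beta> by (intro conjugate_conjugate) simp_all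
      then show ?thesis using \<beta> by simp
    qed
    then have "?\<beta>' \<otimes> (?g \<triangleleft> c) = (?g \<triangleleft> c) \<otimes> ?\<beta>'" using \<beta> by (simp add: conjugate_fixed_iff)
    ultimately have "\<beta> \<otimes> (?g \<triangleleft> c) = (?g \<triangleleft> c) \<otimes> \<beta>" using \<beta> by (meson A_carrier a_closed c_closed commutes_cyclic conjugate_closed m_closed)
    then have "\<beta> \<triangleleft> (a1 \<otimes> c1) = \<beta>" using \<beta> a1 c1 by (simp add: gc conjugate_fixed_iff)
    then have "\<beta> \<triangleleft> c1 = \<beta>" using \<beta> a1 c1 by (simp add: conjugate_by_mult)
    then show ?thesis using \<beta> c1 by (simp add: conjugate_sym[of c1 \<beta>])
  qed
  define N where "N = {z \<in> L. z \<triangleleft> \<beta> = z}"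
  have N_B: "z \<triangleleft> w = z" if z: "z \<in> N" and w: "w \<in> ?B" for z w
  proof -
    have "z \<triangleleft> \<beta> = z" "z \<in> carrier G" using z unfolding N_def by auto
    then have "\<beta> \<otimes> z = z \<otimes> \<beta>" using \<beta> conjugate_fixed_iff[of z \<beta>] by simp
    from commutes_cyclic[OF _ _ this w] show ?thesis
      using z \<beta> w unfolding N_def by (simp add: conjugate_fixed_iff)
  qed
  have N_conj: "z \<triangleleft> y \<in> N" if z: "z \<in> N" and y: "y \<in> carrier G" for z y
  proof -
    have zL: "z \<in> L" using z by (simp add: N_def)
    have "\<beta> \<triangleleft> inv y \<in> ?B" using y by (intro normal_conjugate[OF B]) simp_all
    then have "z \<triangleleft> y = z \<triangleleft> (\<beta> \<triangleleft> inv y) \<triangleleft> y" using N_B[OF z] by simp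
    also have "\<dots> = z \<triangleleft> y \<triangleleft> (\<beta> \<triangleleft> inv y \<triangleleft> y)" using zL y \<beta> by (intro conjugate_conjugate) simp_all
    also have "\<beta> \<triangleleft> inv y \<triangleleft> y = \<beta>" using y \<beta> by simp
    finally have "z \<triangleleft> y \<triangleleft> \<beta> = z \<triangleleft> y" ..
    then show ?thesis unfolding N_def using normal_conjugate[OF L(1) zL y] by simp
  qed
  have N_split: "\<exists>w\<in>?B. \<exists>y\<in>C \<inter> N. z = w \<otimes> y" if z: "z \<in> N" for z
  proof -
    have "z \<in> ?B <#> C" using z L(3) unfolding N_def by blast
    then obtain w y where wy: "w \<in> ?B" "y \<in> C" "z = w \<otimes> y" by (auto simp: set_mult_def)
    then have y: "y = inv w \<otimes> z" by simp
    have "w \<in> A" using wy BA by blast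
    moreover have "y \<in> L" unfolding y
      using z wy(1) L(2) by (intro subgroup.m_closed[OF L_sub] subgroup.m_inv_closed[OF L_sub]) (auto simp: N_def)
    moreover have "y \<triangleleft> \<beta> = y" unfolding y using z wy(1) \<open>w \<in> A\<close> \<beta>
      by (simp add: N_def conjugate_mult)
    ultimately show ?thesis using wy unfolding N_def by blast
  qed
  \<comment> \<open>the \<open>p\<close>-th powers of \<open>N = \<langle>\<beta>\<rangle> \<times> (N \<inter> C)\<close> form a normal subgroup inside \<open>C\<close>\<close>
  have N_pow: "y [^] p = \<one>" if y: "y \<in> C" "y \<in> N" for y
  proof -
    let ?H = "{y [^] p | y. y \<in> C \<inter> N}"
    have "?H \<lhd> G"
    proof (rule normalI_conjugate)
      show "subgroup ?H G"
      proof (rule subgroupI)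
        have "\<one> \<in> C \<inter> N" using \<beta> L_sub by (simp add: N_def subgroup.one_closed)
        then show "?H \<noteq> {}" by blast
      next
        fix u assume "u \<in> ?H"
        then obtain y where y: "y \<in> C" "y \<in> N" "u = y [^] p" by blast
        then have "inv y \<in> C \<inter> N" using L_sub \<beta> by (simp add: N_def conjugate_inv subgroup.m_inv_closed)
        moreover have "inv u = inv y [^] p" using y by (simp add: nat_pow_inv)
        ultimately show "inv u \<in> ?H" by blast
      next
        fix u v assume "u \<in> ?H" "v \<in> ?H"
        then obtain y z where yz: "y \<in> C" "y \<in> N" "u = y [^] p" "z \<in> C" "z \<in> N" "v = z [^] p" by blast
        then have "y \<otimes> z \<in> C \<inter> N" using L_sub \<beta> by (simp add: N_def conjugate_mult subgroup.m_closed)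
        moreover have "u \<otimes> v = (y \<otimes> z) [^] p" using yz by (simp add: pow_mult_distrib C_commute)
        ultimately show "u \<otimes> v \<in> ?H" by blast
      qed auto
      fix u y assume "u \<in> ?H" and y: "y \<in> carrier G"
      then obtain z where z: "z \<in> C" "z \<in> N" "u = z [^] p" by blast
      obtain w z' where wz: "w \<in> ?B" "z' \<in> C" "z' \<in> N" "z \<triangleleft> y = w \<otimes> z'" using N_split[OF N_conj[OF z(2) y]] by blast
      have wz': "w \<otimes> z' = z' \<otimes> w" using N_B[OF wz(3) wz(1)] wz by (simp add: conjugate_fixed_iff)
      have "u \<triangleleft> y = (w \<otimes> z') [^] p" using z y wz(4) by (simp add: conjugate_pow)
      also have "\<dots> = w [^] p \<otimes> z' [^] p" using wz by (intro pow_mult_distrib[OF wz']) simp_all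
      finally have "u \<triangleleft> y = w [^] p \<otimes> z' [^] p" .
      then have "u \<triangleleft> y = z' [^] p" using B_pow[OF wz(1)] wz by simp
      then show "u \<triangleleft> y \<in> ?H" using wz by blast
    qed
    then have "?H = {\<one>}" by (rule core_free) auto
    then show ?thesis using y by blast
  qed
  have c1N: "c1 \<in> N" using c1 \<beta>_c1 by (simp add: N_def)
  have c1p: "c1 [^] p = \<one>" using c1 c1N by (intro N_pow)
  have conj: "\<exists>w\<in>?B. \<exists>d\<in>?D. c1 \<triangleleft> y = w \<otimes> d" if y: "y \<in> carrier G" for y
  proof -
    obtain w z where wz: "w \<in> ?B" "z \<in> C" "z \<in> N" "c1 \<triangleleft> y = w \<otimes> z" using N_split[OF N_conj[OF c1N y]] by blast
    have "z \<in> ?D" by (rule mem_cyclic_if_pow_prime[OF c_closed c1(1) wz(2) p c1p N_pow[OF wz(2,3)] ne])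
    with wz show ?thesis by blast
  qed
  show False
  proof (cases "p = 2")
    case True
    have pow2: "z [^] (2::nat) = z \<otimes> z" if "z \<in> carrier G" for z using that by (simp add: numeral_2_eq_2)
    have two: "z = \<one> \<or> z = u" if u: "u \<in> carrier G" "u \<otimes> u = \<one>" and z: "z \<in> generate G {u}" for u z
      using z
    proof induction
      case (inv h) then show ?case using u by (auto intro: inv_equality)
    next
      case (eng h1 h2) then show ?case using u by auto
    qed auto
    have \<beta>2: "\<beta> \<otimes> \<beta> = \<one>" and c12: "c1 \<otimes> c1 = \<one>" using \<beta> c1 c1p True by (simp_all add: pow2)
    have \<beta>_central: "\<beta> \<triangleleft> y = \<beta>" if y: "y \<in> carrier G" for y
      using two[OF _ \<beta>2 normal_conjugate[OF B mem_cyclic_self y]] y \<beta> by simp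
    have c1_conj: "c1 \<triangleleft> y = c1 \<or> c1 \<triangleleft> y = \<beta> \<otimes> c1" if y: "y \<in> carrier G" for y
    proof -
      obtain w d where wd: "w \<in> ?B" "d \<in> ?D" "c1 \<triangleleft> y = w \<otimes> d" using conj[OF y] by blast
      have w: "w = \<one> \<or> w = \<beta>" using two[OF _ \<beta>2 wd(1)] \<beta> by simp
      have "d \<noteq> \<one>"
      proof
        assume "d = \<one>"
        then have "c1 \<triangleleft> y \<in> ?B" using wd by simp
        from normal_conjugate[OF B this, of "inv y"] y have "c1 \<triangleleft> y \<triangleleft> inv y \<in> ?B" by simp
        then show False using c1_notin c1 y by simp
      qed
      then have "d = c1" using two[OF _ c12 wd(2)] c1 by simp
      then show ?thesis using w wd c1 by auto
    qed
    have \<beta>c1_conj: "(\<beta> \<otimes> c1) \<triangleleft> a = \<beta> \<otimes> (c1 \<triangleleft> a)" using \<beta> c1 by (simp add: conjugate_mult)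
    have c1g: "c1 \<triangleleft> ?g = c1"
    proof -
      have "\<beta> \<otimes> (\<beta> \<otimes> c1) = c1" using \<beta> c1 \<beta>2 by (simp flip: m_assoc)
      then show ?thesis using c1_conj[of a] \<beta>c1_conj c1 by (auto simp: conjugate_by_mult)
    qed
    \<comment> \<open>neither \<open>b\<close> nor \<open>b \<otimes> a\<close> moves \<open>c1\<close>, so \<open>\<langle>c1\<rangle>\<close> is normal\<close>
    have "c1 \<triangleleft> b \<noteq> \<beta> \<otimes> c1"
      using no_cross_term_at_two[OF \<beta>(1) \<beta>2 \<beta>(3) _ c1(1) c12 _ c1g a1 gc] \<beta>_central by auto
    then have c1b: "c1 \<triangleleft> b = c1" using c1_conj[of b] by simp
    interpret R: inverted_product G a "b \<otimes> a" c by (rule other_reflection)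
    have "c1 \<triangleleft> (b \<otimes> a) \<noteq> \<beta> \<otimes> c1"
      using R.no_cross_term_at_two[OF \<beta>(1) \<beta>2 \<beta>(3) _ c1(1) c12 _ c1g a1 gc] \<beta>_central by auto
    then have "c1 \<triangleleft> a = c1" using c1_conj[of a] c1 c1b by (simp add: conjugate_by_mult)
    with c1b core_free_cyclic[OF c1(1)] ne show False by simp
  next
    case False
    then have odd: "odd p" using p primes_dvd_imp_eq two_is_prime_nat by blast
    have "?B \<subseteq> generate G {?g}"
    proof (rule cyclic_incl[OF cyclic_subgroup])
      obtain i :: nat where i: "\<beta> = a [^] i" using \<beta> by (auto simp: mem_cyclic_nat)
      obtain r where r: "p + 1 = 2 * r" using odd by (metis evenE even_plus_one_iff)
      have "\<beta> = \<beta> [^] p \<otimes> \<beta>" using \<beta> by simp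
      also have "\<dots> = \<beta> [^] (p + 1)" by simp
      also have "\<dots> = (a [^] (2::nat)) [^] (i * r)" unfolding r i by (simp add: nat_pow_pow mult.left_commute)
      also have "a [^] (2::nat) = ?g" by (simp add: numeral_2_eq_2)
      finally show "\<beta> \<in> generate G {?g}" using mem_cyclic_nat[of ?g \<beta>] by auto
    qed simp
    then have a1g: "a1 \<in> generate G {?g}"
      unfolding a1_def using x x1 subgroup.m_closed[OF cyclic_subgroup, of ?g] by auto
    have c1b: "c1 \<triangleleft> b = inv c1"
      by (rule reflection_inverts_at_odd_prime[OF p odd \<beta>(1,2) B c1(1) c1p ne \<beta>_c1 conj a1g gc])
    interpret R: inverted_product G a "b \<otimes> a" c by (rule other_reflection)
    have "c1 \<triangleleft> (b \<otimes> a) = inv c1"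
      by (rule R.reflection_inverts_at_odd_prime[OF p odd \<beta>(1,2) B c1(1) c1p ne \<beta>_c1 conj a1g gc])
    then have "inv c1 \<triangleleft> a = inv c1" using c1 by (simp add: conjugate_by_mult c1b)
    then have "inv (c1 \<triangleleft> a) = inv c1" using c1 by (simp add: conjugate_inv)
    then have "c1 \<triangleleft> a = c1" using c1 by (metis C_carrier a_closed conjugate_closed inv_inv)
    moreover have "c1 \<triangleleft> b \<in> ?D" using c1 subgroup.m_inv_closed[OF cyclic_subgroup, of c1 c1] by (simp add: c1b)
    ultimately show False using core_free_cyclic[OF c1(1)] ne by simp
  qed
qed

text \<open>
  The core \<open>L\<close> of \<open>\<langle>\<beta>\<rangle>C\<close> contains all normal subgroups inside \<open>\<langle>\<beta>\<rangle>C\<close>, which makes the image of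
  \<open>C\<close> core-free in the quotient by \<open>L\<close>.
\<close>

lemma a_square_conj_c_step:
  assumes IH: "\<And>(Y :: 'a monoid) a' b' c'. core_free Y a' b' c' \<Longrightarrow> card (carrier Y) < card (carrier G) \<Longrightarrow>
    (a' \<otimes>\<^bsub>Y\<^esub> a') \<triangleleft>\<^bsub>Y\<^esub> c' \<in> generate Y {a' \<otimes>\<^bsub>Y\<^esub> a'}"
  shows "(a \<otimes> a) \<triangleleft> c \<in> generate G {a \<otimes> a}"
proof -
  let ?g = "a \<otimes> a"
  have "?g \<triangleleft> c \<in> A"
  proof (cases "a = \<one>")
    case False
    then obtain H where H: "H \<lhd> G" "H \<subseteq> A" "H \<noteq> {\<one>}" using exists_normal_subgroup_of_A by blast
    have H_sub: "subgroup H G" using H(1) by (rule normal_imp_subgroup)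
    have "\<one> \<in> H" using H_sub by (rule subgroup.one_closed)
    then obtain x where x: "x \<in> H" "x \<noteq> \<one>" using H(3) by blast
    have xA: "x \<in> A" using x H by blast
    then have "ord x \<noteq> 1" using x ord_eq_1[of x] by simp
    then obtain p where p: "prime p" "p dvd ord x" using prime_factor_nat by blast
    then obtain n where n: "ord x = p * n" by blast
    have "ord x > 0" using ord_ge_1[OF finite_carrier, of x] xA by fastforce
    then have "0 < n" "n < ord x" using n prime_gt_1_nat[OF p(1)] by simp_all
    define \<beta> where "\<beta> = x [^] n"
    have \<beta>H: "\<beta> \<in> H" unfolding \<beta>_def
      by (induction n) (use x H_sub in \<open>simp_all add: subgroup.one_closed subgroup.m_closed\<close>)
    have \<beta>A: "\<beta> \<in> A" using \<beta>H H by blast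
    have "\<not> ord x dvd n" using \<open>0 < n\<close> \<open>n < ord x\<close> by (meson dvd_imp_le not_less)
    then have \<beta>1: "\<beta> \<noteq> \<one>" using xA by (simp add: \<beta>_def pow_eq_id)
    have \<beta>p: "\<beta> [^] p = \<one>" using xA pow_ord_eq_1[of x] n by (simp add: \<beta>_def nat_pow_pow mult.commute)
    let ?B = "generate G {\<beta>}"
    have B: "?B \<lhd> G"
    proof (rule cyclic_normalI)
      have "\<beta> \<triangleleft> c \<in> A" using normal_conjugate[OF H(1) \<beta>H, of c] H(2) by auto
      moreover have "(\<beta> \<triangleleft> c) [^] p = \<one>" using \<beta>A by (simp add: \<beta>p flip: conjugate_pow)
      ultimately show "\<beta> \<triangleleft> c \<in> ?B" using \<beta>p \<beta>1 by (intro mem_cyclic_if_pow_prime[OF a_closed \<beta>A _ p(1)])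
      show "\<beta> \<triangleleft> b \<in> ?B" using \<beta>A subgroup.m_inv_closed[OF cyclic_subgroup, of \<beta> \<beta>] by simp
    qed (use \<beta>A in simp_all)
    have BA: "?B \<subseteq> A" using \<beta>A by (intro cyclic_incl[OF A_subgroup])
    have BC: "subgroup (?B <#> C) G"
      by (rule mult_norm_subgroup[OF B C_subgroup])
    define L where "L = core G (?B <#> C)"
    have L: "L \<lhd> G" "L \<subseteq> ?B <#> C" unfolding L_def using BC by (simp_all add: core_normal core_subset)
    have L_greatest: "K \<subseteq> L" if "K \<lhd> G" "K \<subseteq> ?B <#> C" for K
      unfolding L_def using core_greatest[OF BC that] .
    have L_sub: "subgroup L G" using L by (simp add: normal_imp_subgroup)
    have "?B \<subseteq> ?B <#> C"
    proof
      fix z assume z: "z \<in> ?B"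
      moreover have "z = z \<otimes> \<one>" using z BA by auto
      ultimately show "z \<in> ?B <#> C" unfolding set_mult_def using C_ops(2) by blast
    qed
    then have BL: "?B \<subseteq> L" by (rule L_greatest[OF B])
    have split: "y \<in> L" if xy: "x \<in> A" "y \<in> C" "x \<otimes> y \<in> L" for x y
    proof -
      obtain w z where wz: "w \<in> ?B" "z \<in> C" "x \<otimes> y = w \<otimes> z"
        using xy(3) L(2) by (auto simp: set_mult_def)
      then have "x = w" using factor_unique(1)[of x y w z] xy BA by blast
      then have "inv x \<in> L" using wz BL L_sub by (auto intro: subgroup.m_inv_closed)
      then have "inv x \<otimes> (x \<otimes> y) \<in> L" using xy(3) by (rule subgroup.m_closed[OF L_sub])
      then show ?thesis using xy by simp
    qed
    obtain Y :: "'a monoid" and h where Y: "inverted_product Y (h a) (h b) (h c)" and h: "group_hom G Y h"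
      and surj: "h ` carrier G = carrier Y" and ker: "\<And>x. x \<in> carrier G \<Longrightarrow> h x = \<one>\<^bsub>Y\<^esub> \<longleftrightarrow> x \<in> L"
      by (rule quotient[OF L(1)]) (use split in blast, use that in blast)
    interpret Y: inverted_product Y "h a" "h b" "h c" by (rule Y)
    interpret h: group_hom G Y h by (rule h)
    have "core_free Y (h a) (h b) (h c)"
    proof (intro core_free.intro Y core_free_axioms.intro)
      fix K assume K: "K \<lhd> Y" "K \<subseteq> generate Y {h c}"
      let ?P = "{x \<in> carrier G. h x \<in> K}"
      have K_sub: "subgroup K Y" using K by (simp add: normal_imp_subgroup)
      have "?P \<lhd> G"
      proof (rule normalI_conjugate)
        show "subgroup ?P G"
        proof (rule subgroupI)
          show "?P \<noteq> {}" using K_sub by (auto simp: subgroup.one_closed intro!: exI[of _ \<one>])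
        qed (use K_sub in \<open>auto simp: subgroup.m_closed subgroup.m_inv_closed\<close>)
        fix u v assume "u \<in> ?P" "v \<in> carrier G"
        then show "u \<triangleleft> v \<in> ?P" using Y.normal_conjugate[OF K(1)] by (simp add: h.hom_conjugate)
      qed
      moreover have "?P \<subseteq> ?B <#> C"
      proof
        fix u assume u: "u \<in> ?P"
        then have "h u \<in> h ` C" using K(2) by (auto simp: h.hom_cyclic)
        then obtain y where y: "y \<in> C" "h u = h y" by blast
        then have "h (u \<otimes> inv y) = \<one>\<^bsub>Y\<^esub>" using u by simp
        then have "u \<otimes> inv y \<in> L" using u y by (intro ker[THEN iffD1]) simp_all
        then obtain w z where wz: "w \<in> ?B" "z \<in> C" "u \<otimes> inv y = w \<otimes> z" using L(2) by (auto simp: set_mult_def)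
        then have "w \<in> A" using BA by blast
        then have "u = w \<otimes> (z \<otimes> y)" using u y wz by (metis (no_types, lifting) A_carrier C_carrier inv_closed inv_inv inv_solve_right' m_assoc m_closed mem_Collect_eq)
        moreover have "z \<otimes> y \<in> C" using wz y by simp
        ultimately show "u \<in> ?B <#> C" using wz(1) unfolding set_mult_def by blast
      qed
      ultimately have PL: "?P \<subseteq> L" by (rule L_greatest)
      have "u = \<one>\<^bsub>Y\<^esub>" if u: "u \<in> K" for u
      proof -
        have "u \<in> carrier Y" using K_sub u by (rule subgroup.mem_carrier)
        then obtain x where "x \<in> carrier G" "u = h x" using surj by blast
        then show ?thesis using ker PL u by blast
      qed
      then show "K = {\<one>\<^bsub>Y\<^esub>}" using subgroup.one_closed[OF K_sub] by blast
    qed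
    moreover have "card (carrier Y) < card (carrier G)"
    proof -
      have "h \<beta> = h \<one>" using ker[of \<beta>] \<beta>A BL mem_cyclic_self[of \<beta>] by auto
      then have "\<not> inj_on h (carrier G)" using inj_onD[of h "carrier G" \<beta> \<one>] \<beta>1 A_carrier[OF \<beta>A] one_closed by metis
      then have "card (h ` carrier G) \<noteq> card (carrier G)" using eq_card_imp_inj_on[OF finite_carrier] by blast
      then show ?thesis using card_image_le[OF finite_carrier, of h] by (simp add: surj)
    qed
    ultimately have "(h a \<otimes>\<^bsub>Y\<^esub> h a) \<triangleleft>\<^bsub>Y\<^esub> h c \<in> generate Y {h a \<otimes>\<^bsub>Y\<^esub> h a}" by (rule IH)
    moreover have "h (?g \<triangleleft> c) = (h a \<otimes>\<^bsub>Y\<^esub> h a) \<triangleleft>\<^bsub>Y\<^esub> h c" by (simp add: h.hom_conjugate)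
    moreover have "generate Y {h a \<otimes>\<^bsub>Y\<^esub> h a} = h ` generate G {?g}" using h.hom_cyclic[of ?g] by simp
    ultimately have "h (?g \<triangleleft> c) \<in> h ` generate G {?g}" by (simp only:)
    then obtain x where x: "x \<in> generate G {?g}" "h (?g \<triangleleft> c) = h x" by blast
    have gA: "generate G {?g} \<subseteq> A" by (intro cyclic_incl[OF A_subgroup]) simp
    then have xA: "x \<in> A" using x by blast
    have "h (inv x \<otimes> (?g \<triangleleft> c)) = \<one>\<^bsub>Y\<^esub>" using x(2) xA by (simp add: h.hom_conjugate)
    then have in_L: "inv x \<otimes> (?g \<triangleleft> c) \<in> L" using xA by (intro ker[THEN iffD1]) simp_all
    then obtain w y where wy: "w \<in> ?B" "y \<in> C" "inv x \<otimes> (?g \<triangleleft> c) = w \<otimes> y" using L(2) by (auto simp: set_mult_def)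
    have wA: "w \<in> A" using wy BA by blast
    have yL: "y \<in> L" using split[OF wA wy(2)] in_L wy(3) by simp
    have "x \<otimes> (inv x \<otimes> (?g \<triangleleft> c)) = x \<otimes> (w \<otimes> y)" by (simp only: wy(3))
    then have gc: "?g \<triangleleft> c = x \<otimes> w \<otimes> y" using xA wA wy(2) by (simp add: m_assoc)
    have "y = \<one>" by (rule no_cross_term[OF p(1) \<beta>A \<beta>p \<beta>1 B L(1) BL L(2) x(1) wy(1,2) yL gc])
    then show ?thesis using gc xA wA by simp
  qed simp
  then show ?thesis by (intro cyclic_conjugate_closed[of a]) simp_all
qed

end

lemma (in core_free) a_square_conj_c: "(a \<otimes> a) \<triangleleft> c \<in> generate G {a \<otimes> a}"
proof (rule a_square_conj_c_step)
  have "core_free Y a b c \<Longrightarrow> (a \<otimes>\<^bsub>Y\<^esub> a) \<triangleleft>\<^bsub>Y\<^esub> c \<in> generate Y {a \<otimes>\<^bsub>Y\<^esub> a}" for Y :: "'a monoid" and a b c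
  proof (induction "card (carrier Y)" arbitrary: Y a b c rule: less_induct)
    case less
    interpret Y: core_free Y a b c by fact
    show ?case by (rule Y.a_square_conj_c_step) (use less in blast)
  qed
  then show "(a' \<otimes>\<^bsub>Y\<^esub> a') \<triangleleft>\<^bsub>Y\<^esub> c' \<in> generate Y {a' \<otimes>\<^bsub>Y\<^esub> a'}" if "core_free Y a' b' c'" for Y :: "'a monoid" and a' b' c'
    using that .
qed

section \<open>Factorisations by a dihedral or quaternion group\<close>

locale complement = finite_group +
  fixes a b c
  assumes a_closed [simp, intro]: "a \<in> carrier G"
    and b_closed [simp, intro]: "b \<in> carrier G"
    and c_closed [simp, intro]: "c \<in> carrier G"
    and a_conj_b: "a \<triangleleft> b = inv a"
    and b_square: "b \<otimes> b \<in> generate G {a}"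
    and factorisation: "carrier G = generate G {a, b} <#> generate G {c}"
    and trivial_Int: "generate G {a, b} \<inter> generate G {c} = {\<one>}"
begin

abbreviation "A \<equiv> generate G {a}"
abbreviation "C \<equiv> generate G {c}"
abbreviation "D \<equiv> generate G {a, b}"

lemma A_sub: "subgroup A G" and C_sub: "subgroup C G" and D_sub: "subgroup D G"
  by (simp_all add: generate_is_subgroup)

lemma carrier_if [simp]: "x \<in> A \<Longrightarrow> x \<in> carrier G" "x \<in> C \<Longrightarrow> x \<in> carrier G" "x \<in> D \<Longrightarrow> x \<in> carrier G"
  using A_sub C_sub D_sub by (auto dest: subgroup.mem_carrier)

lemmas ops [simp] = subgroup.m_closed[OF A_sub] subgroup.m_inv_closed[OF A_sub]
  subgroup.m_closed[OF C_sub] subgroup.m_inv_closed[OF C_sub]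
  subgroup.m_closed[OF D_sub] subgroup.m_inv_closed[OF D_sub]
  subgroup.one_closed[OF A_sub] subgroup.one_closed[OF C_sub] subgroup.one_closed[OF D_sub]

lemma A_D: "x \<in> A \<Longrightarrow> x \<in> D" and b_D: "b \<in> D"
  using mono_generate[of "{a}" "{a, b}"] by (auto intro: generate.incl)

lemma A_b: "x \<in> A \<Longrightarrow> x \<triangleleft> b = inv x"
  by (auto simp: mem_cyclic_nat conjugate_pow a_conj_b nat_pow_inv)

lemma A_b_swap: assumes "x \<in> A" shows "x \<otimes> b = b \<otimes> inv x"
proof -
  have "x \<otimes> b = b \<otimes> (x \<triangleleft> b)" using assms by (simp add: conjugate_def word_simps)
  then show ?thesis using assms by (simp add: A_b)
qed

lemma A_A: "x \<in> A \<Longrightarrow> y \<in> A \<Longrightarrow> x \<triangleleft> y = x"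
  and C_C: "x \<in> C \<Longrightarrow> y \<in> C \<Longrightarrow> x \<triangleleft> y = x"
  using cyclic_commute[of a x y] cyclic_commute[of c x y] by (simp_all add: conjugate_fixed_iff)

lemma D_cases:
  assumes "x \<in> D" shows "x \<in> A \<or> (\<exists>y\<in>A. x = b \<otimes> y)"
proof -
  let ?S = "A \<union> (\<lambda>y. b \<otimes> y) ` A"
  have S_A: "u \<otimes> v \<in> ?S" if "u \<in> ?S" "v \<in> A" for u v
    using that by (auto simp: m_assoc)
  have S_b: "u \<otimes> b \<in> ?S" if "u \<in> ?S" for u
  proof -
    from that consider "u \<in> A" | y where "y \<in> A" "u = b \<otimes> y" by blast
    then show ?thesis
    proof cases
      case 2
      then have "u \<otimes> b = (b \<otimes> b) \<otimes> inv y" by (simp add: m_assoc A_b_swap)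
      then show ?thesis using 2 b_square by simp
    qed (simp add: A_b_swap)
  qed
  have "inv b = b \<otimes> inv (b \<otimes> b)" by (simp add: inv_mult_group)
  then have S_inv_b: "u \<otimes> inv b \<in> ?S" if "u \<in> ?S" for u
  proof -
    have u: "u \<in> carrier G" using that by auto
    have "u \<otimes> inv b = (u \<otimes> b) \<otimes> inv (b \<otimes> b)" using u by (simp add: inv_mult_group m_assoc)
    then show ?thesis using S_A[OF S_b[OF that], of "inv (b \<otimes> b)"] b_square by simp
  qed
  have "\<forall>u\<in>?S. u \<otimes> x \<in> ?S" using assms
  proof induction
    case one
    show ?case by auto
  next
    case (incl h) then show ?case using S_A[OF _ mem_cyclic_self] S_b by blast
  next
    case (inv h)
    have "inv a \<in> A" by simp
    then show ?case using inv S_A S_inv_b by blast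
  next
    case (eng h1 h2)
    have h: "h1 \<in> carrier G" "h2 \<in> carrier G" using eng by simp_all
    show ?case
    proof
      fix u assume u: "u \<in> ?S"
      then have "u \<otimes> (h1 \<otimes> h2) = (u \<otimes> h1) \<otimes> h2" using h by (auto simp: m_assoc)
      then show "u \<otimes> (h1 \<otimes> h2) \<in> ?S" using eng u by simp
    qed
  qed
  moreover have "\<one> \<in> ?S" by simp
  ultimately have "\<one> \<otimes> x \<in> ?S" by (rule bspec)
  then show ?thesis using assms by auto
qed

lemma carrier_split: assumes "x \<in> carrier G" obtains u y where "u \<in> D" "y \<in> C" "x = u \<otimes> y"
  using assms unfolding factorisation set_mult_def by blast

lemma mem_AC: "x \<in> A <#> C \<longleftrightarrow> (\<exists>u\<in>A. \<exists>y\<in>C. x = u \<otimes> y)"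
  by (auto simp: set_mult_def)

lemma core_C_normal: "core G C \<lhd> G" and core_C_subset: "core G C \<subseteq> C"
  by (simp_all add: core_normal core_subset C_sub)

text \<open>
  \<open>a b = b a\<^sup>-\<^sup>1\<close>, but \<open>a\<close> and \<open>b\<close> act on every cyclic subgroup of \<open>C\<^sub>X\<close> by commuting power maps.
\<close>

lemma a_square_centralizes_core:
  assumes k: "k \<in> core G C" shows "k \<triangleleft> (a \<otimes> a) = k"
proof -
  have conj: "h \<triangleleft> x \<in> generate G {h}" if h: "h \<in> core G C" and x: "x \<in> carrier G" for h x
    using h x core_C_subset normal_conjugate[OF core_C_normal h x]
    by (intro cyclic_conjugate_closed[of c]) auto
  have kc: "k \<in> carrier G" using k core_C_subset by auto
  define h where "h = k \<triangleleft> inv b"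
  have h: "h \<in> core G C" unfolding h_def using k by (intro normal_conjugate[OF core_C_normal]) simp_all
  have hc: "h \<in> carrier G" using h core_C_subset by auto
  have "h \<triangleleft> (b \<otimes> a) = h \<triangleleft> (a \<otimes> b)" using conj[OF h] hc by (intro conjugate_cyclic_commute) simp_all
  also have "a \<otimes> b = b \<otimes> inv a" by (simp add: A_b_swap)
  finally have "k \<triangleleft> a = k \<triangleleft> inv a" using kc unfolding h_def by (simp add: conjugate_by_mult)
  then have "k \<triangleleft> a \<triangleleft> a = k \<triangleleft> inv a \<triangleleft> a" by simp
  then show ?thesis using kc by (simp add: conjugate_by_mult)
qed

lemma mem_centralizer_core:
  "x \<in> centralizer G (core G C) \<longleftrightarrow> x \<in> carrier G \<and> (\<forall>h\<in>core G C. h \<triangleleft> x = h)"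
  using core_C_subset by (auto simp: centralizer_def conjugate_fixed_iff subset_iff)

lemma centralizer_core_normal: "centralizer G (core G C) \<lhd> G"
proof (rule normalI_conjugate)
  have cc: "h \<in> carrier G" if "h \<in> core G C" for h using that core_C_subset by auto
  show "subgroup (centralizer G (core G C)) G"
  proof (rule subgroupI)
    have "\<one> \<in> centralizer G (core G C)" using cc by (simp add: mem_centralizer_core)
    then show "centralizer G (core G C) \<noteq> {}" by blast
  next
    fix x assume "x \<in> centralizer G (core G C)"
    then show "inv x \<in> centralizer G (core G C)"
      using cc by (auto simp: mem_centralizer_core) (metis conjugate_conjugate_inv(1))
  qed (use cc in \<open>auto simp: mem_centralizer_core conjugate_by_mult\<close>)
  fix z x assume z: "z \<in> centralizer G (core G C)" and x: "x \<in> carrier G"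
  have "h \<triangleleft> (z \<triangleleft> x) = h" if h: "h \<in> core G C" for h
  proof -
    have "h \<triangleleft> inv x \<in> core G C" using x h by (intro normal_conjugate[OF core_C_normal]) simp_all
    then have "h \<triangleleft> inv x \<triangleleft> z = h \<triangleleft> inv x" using z by (simp add: mem_centralizer_core)
    then show ?thesis using z x cc[OF h] by (simp add: conjugate_by_conjugate mem_centralizer_core)
  qed
  then show "z \<triangleleft> x \<in> centralizer G (core G C)" using z x by (simp add: mem_centralizer_core)
qed

lemma generate_subset_centralizer: "generate G {a \<otimes> a, c} \<subseteq> centralizer G (core G C)"
proof (rule generate_subgroup_incl)
  show "{a \<otimes> a, c} \<subseteq> centralizer G (core G C)"
    using a_square_centralizes_core core_C_subset C_C by (auto simp: mem_centralizer_core)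
qed (rule normal_imp_subgroup[OF centralizer_core_normal])

lemma card_rcosets_centralizer: "card (rcosets (centralizer G (core G C))) \<le> 4"
proof -
  let ?Z = "centralizer G (core G C)" and ?T = "{\<one>, a, b, b \<otimes> a}"
  have Z: "subgroup ?Z G" by (rule normal_imp_subgroup[OF centralizer_core_normal])
  have Zc [simp]: "z \<in> carrier G" if "z \<in> ?Z" for z using that by (simp add: mem_centralizer_core)
  have gen: "generate G {a \<otimes> a} \<subseteq> ?Z" "C \<subseteq> ?Z"
    using mono_generate[of "{a \<otimes> a}" "{a \<otimes> a, c}"] mono_generate[of "{c}" "{a \<otimes> a, c}"] generate_subset_centralizer by auto
  have "rcosets ?Z \<subseteq> (\<lambda>t. ?Z #> t) ` ?T"
  proof
    fix R assume "R \<in> rcosets ?Z"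
    then obtain x where x: "x \<in> carrier G" "R = ?Z #> x" by (auto simp: RCOSETS_def)
    obtain u y where uy: "u \<in> D" "y \<in> C" "x = u \<otimes> y" using x(1) by (rule carrier_split)
    have pow: "\<exists>t\<in>{\<one>, a}. \<exists>z\<in>?Z. w = t \<otimes> z" if w: "w \<in> A" for w
    proof -
      obtain i :: nat where i: "w = a [^] i" using w by (auto simp: mem_cyclic_nat)
      have "a [^] (2 * j) = (a \<otimes> a) [^] j" for j :: nat
        using nat_pow_pow[of a 2 j] by (simp add: numeral_2_eq_2)
      then have "a [^] (2 * j) \<in> generate G {a \<otimes> a}" for j :: nat using mem_cyclic_nat[of "a \<otimes> a"] by auto
      then have ev: "a [^] (2 * j) \<in> ?Z" for j :: nat using gen(1) by blast
      show ?thesis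
      proof (cases "even i")
        case True
        then obtain j where "i = 2 * j" by blast
        then show ?thesis using ev[of j] i by auto
      next
        case False
        then obtain j where "i = Suc (2 * j)" by (auto elim: oddE)
        then have "w = a \<otimes> a [^] (2 * j)" unfolding i by (simp only: nat_pow_Suc2[OF a_closed])
        then show ?thesis using ev[of j] by auto
      qed
    qed
    have "\<exists>t\<in>?T. \<exists>z\<in>?Z. u = t \<otimes> z"
    proof -
      from D_cases[OF uy(1)] consider "u \<in> A" | w where "w \<in> A" "u = b \<otimes> w" by blast
      then show ?thesis
      proof cases
        case 1 then show ?thesis using pow[of u] by blast
      next
        case 2
        then obtain t z where "t \<in> {\<one>, a}" "z \<in> ?Z" "w = t \<otimes> z" using pow by blast
        then have "u = (b \<otimes> t) \<otimes> z" "b \<otimes> t \<in> ?T" using 2 by (auto simp: m_assoc)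
        then show ?thesis using \<open>z \<in> ?Z\<close> by blast
      qed
    qed
    then obtain t z where tz: "t \<in> ?T" "z \<in> ?Z" "u = t \<otimes> z" by blast
    have t: "t \<in> carrier G" using tz by auto
    have zy: "z \<otimes> y \<in> ?Z" using tz uy gen(2) Z by (auto intro: subgroup.m_closed)
    have "(z \<otimes> y) \<triangleleft> inv t \<in> ?Z" using zy t by (intro normal_conjugate[OF centralizer_core_normal]) simp_all
    moreover have "x = (z \<otimes> y) \<triangleleft> inv t \<otimes> t" using tz uy t by (simp add: conjugate_def m_assoc)
    ultimately have "x \<in> ?Z #> t" by (auto simp: r_coset_def)
    then have "?Z #> t = ?Z #> x" using t Z by (intro repr_independence)
    then show "R \<in> (\<lambda>t. ?Z #> t) ` ?T" using x tz by blast
  qed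
  then have "card (rcosets ?Z) \<le> card ((\<lambda>t. ?Z #> t) ` ?T)" by (intro card_mono) simp_all
  also have "\<dots> \<le> card ?T" by (intro card_image_le) simp
  also have "\<dots> \<le> 4" using card_length[of "[\<one>, a, b, b \<otimes> a]"] by simp
  finally show ?thesis .
qed

text \<open>
  The product \<open>P = N D\<close> satisfies \<open>P = D C1\<close> with \<open>C1 = P \<inter> C\<close>. If \<open>y = u v \<in> C1\<close> with \<open>u \<in> N\<close> and
  \<open>v \<in> D\<close>, then \<open>u\<^sup>-\<^sup>1 = x' y'\<close> with \<open>x' \<in> A\<close> and \<open>y' \<in> C\<close>, and \<open>x'\<^sup>-\<^sup>1 v = y' y\<close> lies in \<open>D \<inter> C = 1\<close>; so
  \<open>v \<in> A\<close>. Hence \<open>A C1 = N A\<close> is a subgroup, and the result for products that are subgroups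
  applies to \<open>P\<close>.
\<close>

lemma normalizes_a_square:
  assumes cf: "core G C = {\<one>}" and N: "N \<lhd> G" "N \<subseteq> A <#> C"
    and z: "z \<in> generate G {a \<otimes> a}" and n: "n \<in> N"
  shows "z \<triangleleft> n \<in> generate G {a \<otimes> a}"
proof -
  define P where "P = N <#> D"
  have P: "subgroup P G" unfolding P_def by (rule mult_norm_subgroup[OF N(1) D_sub])
  have N_sub: "subgroup N G" using N by (simp add: normal_imp_subgroup)
  have Nc [simp]: "x \<in> carrier G" if "x \<in> N" for x using N_sub that by (rule subgroup.mem_carrier)
  have Pc [simp]: "x \<in> carrier G" if "x \<in> P" for x using P that by (rule subgroup.mem_carrier)
  have NG_mult: "x \<otimes> y \<in> P" if "x \<in> N" "y \<in> D" for x y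
    unfolding P_def set_mult_def using that by blast
  have N_P: "x \<in> P" if "x \<in> N" for x
    using that NG_mult[of x \<one>] by simp
  have D_P: "x \<in> P" if "x \<in> D" for x
    using that NG_mult[of \<one> x] subgroup.one_closed[OF N_sub] by simp
  have A_P: "x \<in> P" if "x \<in> A" for x using that by (intro D_P A_D)
  have b_P: "b \<in> P" by (intro D_P b_D)
  have P_cases: "\<exists>u\<in>N. \<exists>v\<in>D. x = u \<otimes> v" if "x \<in> P" for x using that by (auto simp: P_def set_mult_def)
  have "subgroup (P \<inter> C) G" using P C_sub by (rule subgroups_Inter_pair)
  then obtain k :: nat where k: "P \<inter> C = generate G {c [^] k}" by (rule subgroup_of_cyclic[OF c_closed]) auto
  define c1 where "c1 = c [^] k"
  have C1: "generate G {c1} = P \<inter> C" by (simp add: k c1_def)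
  have c1P: "c1 \<in> P" "c1 \<in> C" using C1 mem_cyclic_self[of c1] by auto
  have NA: "subgroup (N <#> A) G" by (rule mult_norm_subgroup[OF N(1) A_sub])
  have NA_iff: "x \<in> N <#> A \<longleftrightarrow> (\<exists>u\<in>N. \<exists>v\<in>A. x = u \<otimes> v)" for x by (auto simp: set_mult_def)
  have AC1_iff: "x \<in> A <#> (P \<inter> C) \<longleftrightarrow> (\<exists>u\<in>A. \<exists>v\<in>P \<inter> C. x = u \<otimes> v)" for x by (auto simp: set_mult_def)
  have PC_NA: "y \<in> N <#> A" if y: "y \<in> P" "y \<in> C" for y
  proof -
    obtain u v where uv: "u \<in> N" "v \<in> D" "y = u \<otimes> v" using P_cases[OF y(1)] by blast
    have "inv u \<in> N" using uv N_sub by (simp add: subgroup.m_inv_closed)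
    then obtain x' y' where xy: "x' \<in> A" "y' \<in> C" "inv u = x' \<otimes> y'" using N(2) unfolding mem_AC[symmetric] by (metis mem_AC subsetD)
    have "v = inv u \<otimes> y" using uv by simp
    also have "\<dots> = x' \<otimes> (y' \<otimes> y)" unfolding xy(3) using xy y by (simp add: m_assoc)
    finally have v: "inv x' \<otimes> v = y' \<otimes> y" using xy y by simp
    have "y' \<otimes> y \<in> C" using xy y by simp
    moreover have "inv x' \<otimes> v \<in> D" using xy uv A_D[of "inv x'"] by simp
    ultimately have "inv x' \<otimes> v = \<one>" using trivial_Int v by auto
    then have "v = x'" using xy uv by (metis carrier_if(1,3) inv_closed inv_equality inv_inv)
    then show ?thesis using uv xy unfolding NA_iff by blast
  qed
  have AC1: "A <#> (P \<inter> C) = N <#> A"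
  proof (intro equalityI subsetI)
    fix x assume "x \<in> A <#> (P \<inter> C)"
    then obtain u v where uv: "u \<in> A" "v \<in> P" "v \<in> C" "x = u \<otimes> v" unfolding AC1_iff by blast
    have "u \<in> N <#> A" unfolding NA_iff using uv subgroup.one_closed[OF N_sub] by (metis carrier_if(1) l_one)
    then show "x \<in> N <#> A" unfolding uv(4) using PC_NA[OF uv(2,3)] by (rule subgroup.m_closed[OF NA])
  next
    fix x assume "x \<in> N <#> A"
    then obtain u v where uv: "u \<in> N" "v \<in> A" "x = u \<otimes> v" unfolding NA_iff by blast
    have uvN: "u \<triangleleft> v \<in> N" using uv by (intro normal_conjugate[OF N(1)]) simp_all
    then have "u \<triangleleft> v \<in> A <#> C" using N(2) by blast
    then obtain x' y' where xy: "x' \<in> A" "y' \<in> C" "u \<triangleleft> v = x' \<otimes> y'" unfolding mem_AC by blast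
    have "y' = inv x' \<otimes> (u \<triangleleft> v)" using xy by simp
    moreover have "inv x' \<otimes> (u \<triangleleft> v) \<in> P" using xy N_P[OF uvN] A_P[of "inv x'"] by (intro subgroup.m_closed[OF P]) simp_all
    ultimately have "y' \<in> P \<inter> C" using xy by simp
    moreover have "x = v \<otimes> (u \<triangleleft> v)" using uv by (simp add: conjugate_def word_simps)
    then have "x = (v \<otimes> x') \<otimes> y'" unfolding xy(3) using uv xy by (simp add: m_assoc)
    moreover have "v \<otimes> x' \<in> A" using uv xy by simp
    ultimately show "x \<in> A <#> (P \<inter> C)" unfolding AC1_iff by blast
  qed
  have NA_P: "N <#> A \<subseteq> P" unfolding P_def set_mult_def using A_D by blast
  let ?X = "G\<lparr>carrier := P\<rparr>"
  interpret X: group ?X by (rule subgroup_imp_group[OF P])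
  have genA: "generate ?X {a} = A" using A_P[of a] by (intro generate_consistent) (simp_all add: P)
  have genC: "generate ?X {c1} = P \<inter> C" using c1P by (subst generate_consistent) (simp_all add: P C1)
  have conjX: "x \<triangleleft>\<^bsub>?X\<^esub> y = x \<triangleleft> y" if "x \<in> P" "y \<in> P" for x y using P that by (rule conjugate_consistent)
  have aP: "a \<in> P" using A_P[of a] by simp
  have "core_free ?X a b c1"
  proof (intro core_free.intro inverted_product.intro finite_group.intro finite_group_axioms.intro
      inverted_product_axioms.intro core_free_axioms.intro X.is_group)
    show "finite (carrier ?X)" using finite_subset[OF subgroup.subset[OF P]] by simp
    show "a \<in> carrier ?X" "b \<in> carrier ?X" "c1 \<in> carrier ?X" using aP b_P c1P by simp_all
    show "a \<triangleleft>\<^bsub>?X\<^esub> b = inv\<^bsub>?X\<^esub> a" using aP b_P P by (simp add: conjX a_conj_b)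
    show "b \<otimes>\<^bsub>?X\<^esub> b \<in> generate ?X {a}" unfolding genA using b_square by simp
    show "subgroup (generate ?X {a} <#>\<^bsub>?X\<^esub> generate ?X {c1}) ?X"
      unfolding genA genC set_mult_consistent using NA NA_P P by (simp add: AC1 subgroup_incl)
    show "c1 \<triangleleft>\<^bsub>?X\<^esub> b \<in> generate ?X {a} <#>\<^bsub>?X\<^esub> generate ?X {c1}"
    proof -
      obtain u v where uv: "u \<in> N" "v \<in> A" "c1 = u \<otimes> v" using PC_NA[OF c1P] unfolding NA_iff by blast
      have "u \<triangleleft> b \<in> N" using uv by (intro normal_conjugate[OF N(1)]) simp_all
      moreover have "c1 \<triangleleft> b = (u \<triangleleft> b) \<otimes> inv v" using uv by (simp add: conjugate_mult A_b)
      moreover have "inv v \<in> A" using uv by simp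
      ultimately have "c1 \<triangleleft> b \<in> N <#> A" unfolding NA_iff by blast
      then show ?thesis unfolding genA genC set_mult_consistent AC1 using conjX[OF c1P(1) b_P] by simp
    qed
    show "\<exists>y\<in>generate ?X {a} <#>\<^bsub>?X\<^esub> generate ?X {c1}. x = y \<or> x = b \<otimes>\<^bsub>?X\<^esub> y" if "x \<in> carrier ?X" for x
    proof -
      obtain u v where uv: "u \<in> N" "v \<in> D" "x = u \<otimes> v" using P_cases[of x] \<open>x \<in> carrier ?X\<close> by auto
      have "\<exists>y\<in>N <#> A. x = y \<or> x = b \<otimes> y"
      proof (cases "v \<in> A")
        case True
        then have "x \<in> N <#> A" using uv(1,3) unfolding NA_iff by blast
        then show ?thesis by (intro bexI[of _ x]) simp_all
      next
        case False
        then obtain w where w: "w \<in> A" "v = b \<otimes> w" using D_cases[OF uv(2)] by blast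
        have "u \<triangleleft> b \<in> N" using uv by (intro normal_conjugate[OF N(1)]) simp_all
        then have "(u \<triangleleft> b) \<otimes> w \<in> N <#> A" using w unfolding NA_iff by blast
        moreover have "x = b \<otimes> ((u \<triangleleft> b) \<otimes> w)" using uv w by (simp add: conjugate_def word_simps)
        ultimately show ?thesis by (intro bexI[of _ "(u \<triangleleft> b) \<otimes> w"]) simp_all
      qed
      then show ?thesis unfolding genA genC set_mult_consistent AC1 by simp
    qed
    show "generate ?X {a} \<inter> generate ?X {c1} = {\<one>\<^bsub>?X\<^esub>}"
    proof -
      have "A \<inter> (P \<inter> C) \<subseteq> {\<one>}" using trivial_Int A_D by blast
      moreover have "\<one> \<in> A \<inter> (P \<inter> C)" using subgroup.one_closed[OF P] by simp
      ultimately show ?thesis unfolding genA genC by auto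
    qed
    fix H assume H: "H \<lhd> ?X" "H \<subseteq> generate ?X {c1}"
    have H_sub: "subgroup H G" using incl_subgroup[OF P] H(1) normal_imp_subgroup by blast
    have HC: "H \<subseteq> P \<inter> C" using H(2) by (simp add: genC)
    have "H \<lhd> G"
    proof (rule normalI_conjugate[OF H_sub])
      fix h x assume h: "h \<in> H" and x: "x \<in> carrier G"
      obtain u y where uy: "u \<in> D" "y \<in> C" "x = u \<otimes> y" using x by (rule carrier_split)
      have "h \<triangleleft>\<^bsub>?X\<^esub> u \<in> H" using X.normal_conjugate[OF H(1) h] D_P[OF uy(1)] by simp
      then have hu: "h \<triangleleft> u \<in> H" using conjX[OF _ D_P[OF uy(1)], of h] h HC by auto
      then have "h \<triangleleft> u \<in> C" using HC by blast
      then have "h \<triangleleft> x = h \<triangleleft> u" using uy h HC C_C by (auto simp: conjugate_by_mult)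
      with hu show "h \<triangleleft> x \<in> H" by simp
    qed
    then have "H \<subseteq> core G C" using HC by (intro core_greatest[OF C_sub]) blast+
    then have "H \<subseteq> {\<one>}" unfolding cf .
    then show "H = {\<one>\<^bsub>?X\<^esub>}" using subgroup.one_closed[OF H_sub] by auto
  qed
  then have "(a \<otimes>\<^bsub>?X\<^esub> a) \<triangleleft>\<^bsub>?X\<^esub> c1 \<in> generate ?X {a \<otimes>\<^bsub>?X\<^esub> a}" by (rule core_free.a_square_conj_c)
  moreover have aaP: "a \<otimes> a \<in> P" using aP P by (simp add: subgroup.m_closed)
  moreover have "generate ?X {a \<otimes> a} = generate G {a \<otimes> a}" using aaP by (intro generate_consistent) (simp_all add: P)
  ultimately have gc1: "(a \<otimes> a) \<triangleleft> c1 \<in> generate G {a \<otimes> a}" using conjX[OF aaP c1P(1)] by simp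
  have E_sub: "subgroup (generate G {a \<otimes> a}) G" by (simp add: cyclic_subgroup)
  have E_c1: "w \<triangleleft> c1 \<in> generate G {a \<otimes> a}" if w: "w \<in> generate G {a \<otimes> a}" for w
  proof -
    obtain i :: nat where i: "w = (a \<otimes> a) [^] i" using w mem_cyclic_nat[of "a \<otimes> a" w] by auto
    have "((a \<otimes> a) \<triangleleft> c1) [^] i \<in> generate G {a \<otimes> a}"
      by (induction i) (use gc1 E_sub in \<open>simp_all add: subgroup.m_closed subgroup.one_closed\<close>)
    then show ?thesis using i c1P by (simp add: conjugate_pow)
  qed
  have "n = n \<otimes> \<one>" using n by simp
  then have "n \<in> N <#> A" unfolding NA_iff using n ops(7) by blast
  then obtain x y where xy: "x \<in> A" "y \<in> P" "y \<in> C" "n = x \<otimes> y" unfolding AC1[symmetric] AC1_iff by blast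
  then have "y \<in> generate G {c1}" by (simp add: C1)
  then obtain i :: nat where i: "y = c1 [^] i" using mem_cyclic_nat[of c1 y] c1P by auto
  have zA: "z \<in> A" using z cyclic_incl[OF A_sub, of "a \<otimes> a"] by auto
  have "z \<triangleleft> (c1 [^] i) \<in> generate G {a \<otimes> a}"
    by (induction i) (use z zA c1P E_c1 in \<open>simp_all add: conjugate_by_mult\<close>)
  then show ?thesis using xy zA i A_A by (simp add: conjugate_by_mult)
qed

lemma core_Int_a_square_normal:
  assumes cf: "core G C = {\<one>}" and M: "subgroup M G" "M \<subseteq> A <#> C"
  shows "core G M \<inter> generate G {a \<otimes> a} \<lhd> G\<lparr>carrier := core G M\<rparr>"
proof -
  let ?N = "core G M" and ?E = "generate G {a \<otimes> a}"
  have N: "?N \<lhd> G" using M by (simp add: core_normal)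
  have NAC: "?N \<subseteq> A <#> C" using core_subset[OF M(1)] M(2) by blast
  have N_sub: "subgroup ?N G" using N by (rule normal_imp_subgroup)
  have E_sub: "subgroup ?E G" by (simp add: cyclic_subgroup)
  interpret X: group "G\<lparr>carrier := ?N\<rparr>" by (rule subgroup_imp_group[OF N_sub])
  show ?thesis
  proof (rule X.normalI_conjugate)
    show "subgroup (?N \<inter> ?E) (G\<lparr>carrier := ?N\<rparr>)"
      using subgroups_Inter_pair[OF N_sub E_sub] N_sub by (rule subgroup_incl) simp
    fix h x assume hx: "h \<in> ?N \<inter> ?E" "x \<in> carrier (G\<lparr>carrier := ?N\<rparr>)"
    then have "h \<triangleleft> x \<in> ?E" by (intro normalizes_a_square[OF cf N NAC]) auto
    moreover have "h \<triangleleft> x \<in> ?N" using hx subgroup.mem_carrier[OF N_sub] by (intro normal_conjugate[OF N]) auto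
    ultimately show "h \<triangleleft>\<^bsub>G\<lparr>carrier := ?N\<rparr>\<^esub> x \<in> ?N \<inter> ?E" using hx by (simp add: conjugate_consistent[OF N_sub])
  qed
qed

lemma carrier_cases_AC:
  assumes "x \<in> carrier G" shows "x \<in> A <#> C \<or> (\<exists>m\<in>A <#> C. x = b \<otimes> m)"
proof -
  obtain u y where uy: "u \<in> D" "y \<in> C" "x = u \<otimes> y" using assms by (rule carrier_split)
  from D_cases[OF uy(1)] consider "u \<in> A" | w where "w \<in> A" "u = b \<otimes> w" by blast
  then show ?thesis
  proof cases
    case 1 then show ?thesis using uy unfolding mem_AC by blast
  next
    case 2
    then have "x = b \<otimes> (w \<otimes> y)" using uy by (simp add: m_assoc)
    moreover have "w \<otimes> y \<in> A <#> C" using 2 uy unfolding mem_AC by blast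
    ultimately show ?thesis by blast
  qed
qed

text \<open>
  The union of \<open>AC\<close> and \<open>bAC\<close> is everything, so \<open>AC\<close> has index at most two.
\<close>

lemma AC_normal:
  assumes M: "subgroup (A <#> C) G" shows "A <#> C \<lhd> G"
proof (rule normalI_conjugate[OF M])
  let ?M = "A <#> C"
  have Mc [simp]: "x \<in> carrier G" if "x \<in> ?M" for x using M that by (rule subgroup.mem_carrier)
  have conj: "m \<triangleleft> x \<in> ?M" if "m \<in> ?M" "x \<in> ?M" for m x
    unfolding conjugate_def using that M by (intro subgroup.m_closed subgroup.m_inv_closed) simp_all
  have conj_b: "m \<triangleleft> b \<in> ?M" if m: "m \<in> ?M" for m
  proof (cases "b \<in> ?M")
    case False
    have "m \<otimes> b \<notin> ?M"
    proof
      assume "m \<otimes> b \<in> ?M"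
      then have "inv m \<otimes> (m \<otimes> b) \<in> ?M" by (rule subgroup.m_closed[OF M subgroup.m_inv_closed[OF M m]])
      with False m show False by simp
    qed
    then obtain m' where "m' \<in> ?M" "m \<otimes> b = b \<otimes> m'" using carrier_cases_AC[of "m \<otimes> b"] m by auto
    then show ?thesis using m by (simp add: conjugate_def m_assoc)
  qed (use m conj in simp)
  fix m x assume m: "m \<in> ?M" and x: "x \<in> carrier G"
  from carrier_cases_AC[OF x] show "m \<triangleleft> x \<in> ?M"
    using m conj conj_b[OF m] by (auto simp: conjugate_by_mult)
qed

lemma a_square_normal:
  assumes cf: "core G C = {\<one>}" and M: "subgroup (A <#> C) G"
  shows "generate G {a \<otimes> a} \<lhd> G"
proof (rule normalI_conjugate)
  let ?E = "generate G {a \<otimes> a}"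
  show E_sub: "subgroup ?E G" by (simp add: cyclic_subgroup)
  have EA: "z \<in> A" if "z \<in> ?E" for z using that cyclic_incl[OF A_sub, of "a \<otimes> a"] by auto
  fix z x assume z: "z \<in> ?E" and x: "x \<in> carrier G"
  note conj = normalizes_a_square[OF cf AC_normal[OF M] order_refl]
  from carrier_cases_AC[OF x] show "z \<triangleleft> x \<in> ?E"
  proof (elim disjE bexE)
    fix m assume m: "m \<in> A <#> C" "x = b \<otimes> m"
    have "inv z \<in> ?E" using z E_sub by (simp add: subgroup.m_inv_closed)
    then have "inv z \<triangleleft> m \<in> ?E" using m(1) by (rule conj)
    moreover have "m \<in> carrier G" using M m(1) by (rule subgroup.mem_carrier)
    ultimately show ?thesis using EA[OF z] m(2) by (simp add: conjugate_by_mult A_b)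
  qed (rule conj[OF z])
qed

end

lemma word_val_Nil [simp]: "word_val G f [] = \<one>\<^bsub>G\<^esub>"
  and word_val_Cons [simp]: "word_val G f ((g, e) # w) = (if e then f g else inv\<^bsub>G\<^esub> f g) \<otimes>\<^bsub>G\<^esub> word_val G f w"
  by (simp_all add: word_val_def)

lemma (in group) word_val_replicate:
  "f g \<in> carrier G \<Longrightarrow> word_val G f (replicate n (g, True)) = f g [^] n"
proof (induction n)
  case (Suc n)
  then show ?case using nat_pow_comm[of "f g" 1 n] by simp
qed simp

theorem theorem1p2:
  fixes X :: "('x, 'r) monoid_scheme" and G M :: "'x set" and a b c :: 'x and n m :: nat
  assumes "group X" and "finite (carrier X)"
    and "subgroup G X"
    and "n \<ge> 2"
    and "quaternion_on X G a b n \<or> dihedral_on X G a b n"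
    and "c \<in> carrier X" and "group.ord X c = m" and "m \<ge> 2"
    and "carrier X = G <#>\<^bsub>X\<^esub> generate X {c}"
    and "G \<inter> generate X {c} = {\<one>\<^bsub>X\<^esub>}"
    and "subgroup M X"
    and "generate X {c} \<subseteq> M"
    and "M \<subseteq> generate X {a} <#>\<^bsub>X\<^esub> generate X {c}"
    and "\<And>K. subgroup K X \<Longrightarrow> generate X {c} \<subseteq> K \<Longrightarrow>
           K \<subseteq> generate X {a} <#>\<^bsub>X\<^esub> generate X {c} \<Longrightarrow> card K \<le> card M"
  shows "generate X {a [^]\<^bsub>X\<^esub> (2::nat), c} \<subseteq> centralizer X (core X (generate X {c})) \<and>
    card (rcosets\<^bsub>X\<^esub> (centralizer X (core X (generate X {c})))) \<le> 4 \<and>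
    (core X (generate X {c}) = {\<one>\<^bsub>X\<^esub>} \<longrightarrow>
       core X M \<inter> generate X {a [^]\<^bsub>X\<^esub> (2::nat)} \<lhd> X\<lparr>carrier := core X M\<rparr>) \<and>
    (core X (generate X {c}) = {\<one>\<^bsub>X\<^esub>} \<and> M = generate X {a} <#>\<^bsub>X\<^esub> generate X {c} \<longrightarrow>
       generate X {a [^]\<^bsub>X\<^esub> (2::nat)} \<lhd> X)"
proof -
  interpret X: group X by fact
  obtain R where pres: "presented_by X G (case_gen a b) R"
    and R: "R = quaternion_rels n \<or> R = dihedral_rels n"
    using assms(5) by (auto simp: quaternion_on_def dihedral_on_def)
  have range: "range (case_gen a b) = {a, b}"
    by (auto simp: image_iff split: gen.split)
  have ab: "a \<in> carrier X" "b \<in> carrier X" and G: "G = generate X {a, b}"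
    using pres by (simp_all add: presented_by_def range)
  have rels: "word_val X (case_gen a b) u = word_val X (case_gen a b) v" if "(u, v) \<in> R" for u v
    using pres that word_eq.rel by (auto simp: presented_by_def)
  have conj: "a \<triangleleft>\<^bsub>X\<^esub> b = inv\<^bsub>X\<^esub> a"
    using rels[of "[(Gen_b, False), (Gen_a, True), (Gen_b, True)]" "[(Gen_a, False)]"] R ab
    by (auto simp: quaternion_rels_def dihedral_rels_def conjugate_def X.m_assoc)
  have bb: "word_val X (case_gen a b) (replicate 2 (Gen_b, True)) = b \<otimes>\<^bsub>X\<^esub> b"
    using ab by (simp add: numeral_2_eq_2)
  have square: "b \<otimes>\<^bsub>X\<^esub> b \<in> generate X {a}"
    using R
  proof
    assume "R = quaternion_rels n"
    then have "b \<otimes>\<^bsub>X\<^esub> b = a [^]\<^bsub>X\<^esub> n"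
      using rels[of "replicate 2 (Gen_b, True)" "replicate n (Gen_a, True)"] ab
      unfolding bb by (simp add: quaternion_rels_def X.word_val_replicate)
    moreover have "a [^]\<^bsub>X\<^esub> n \<in> generate X {a}"
      using X.mem_cyclic_int[OF ab(1)] int_pow_int[of X a n] by metis
    ultimately show ?thesis by simp
  next
    assume "R = dihedral_rels n"
    then have "b \<otimes>\<^bsub>X\<^esub> b = \<one>\<^bsub>X\<^esub>"
      using rels[of "replicate 2 (Gen_b, True)" "[]"] unfolding bb by (simp add: dihedral_rels_def)
    then show ?thesis by (simp add: generate.one)
  qed
  interpret complement X a b c
    using assms(2,6,9,10) ab conj square unfolding G by unfold_locales
  have a2: "a [^]\<^bsub>X\<^esub> (2::nat) = a \<otimes>\<^bsub>X\<^esub> a" using ab by (simp add: numeral_2_eq_2)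
  show ?thesis unfolding a2
    using generate_subset_centralizer card_rcosets_centralizer core_Int_a_square_normal[OF _ assms(11,13)]
      a_square_normal assms(11) by blast
qed

end
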